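(* Let $G$ be a $2$-dimensional Lie group with Lie algebra $\mathfrak{g}$ of left-invariant vector fields, and let $\langle\cdot,\cdot\rangle$ be a left-invariant Lorentzian metric on $G$. Assume that $X\in\mathfrak{g}$ is a non-Killing conformal vector field. Then there is a basis $\{e_1,e_2\}$ of $\mathfrak{g}$ such that the non-zero bracket is given by $[e_1,e_2]=e_2$ and the Lorentzian metric is given in this basis by the matrix $$\langle\cdot,\cdot\rangle=\begin{pmatrix}0&1\\1&0\end{pmatrix}.$$ In particular, $X=x_1e_1$ for some $x_1\in\mathbb{R}$.
   Context: A metric on $G$ is left-invariant if all left translations are isometries. A vector field $X$ is conformal if $\mathfrak{L}_X\langle\cdot,\cdot\rangle=2\rho\langle\cdot,\cdot\rangle$ for some smooth function $\rho$ on $G$, where $\mathfrak{L}_X$ is the Lie derivative, $(\mathfrak{L}_X\langle\cdot,\cdot\rangle)(Y,Z)=X\langle Y,Z\rangle-\langle[X,Y],Z\rangle-\langle Y,[X,Z]\rangle$. A vector field $X$ is Killing if $\mathfrak{L}_X\langle\cdot,\cdot\rangle=0$. The matrix of the metric in a basis $\{e_i\}$ has entries $\langle e_i,e_j\rangle$. *)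

theory Defs
  imports "HOL-Analysis.Analysis" "HOL-Algebra.Group" "HOL-Library.Function_Algebras"
begin

text \<open>
  Function spaces with values in a real vector space are real vector spaces.  Hence tangent vectors
  (derivations) and vector fields below live in real vector spaces, and \<^const>\<open>span\<close> and
  \<^const>\<open>independent\<close> apply to them.
\<close>

instantiation "fun" :: (type, real_vector) real_vector
begin

definition scaleR_fun :: "real \<Rightarrow> ('a \<Rightarrow> 'b) \<Rightarrow> 'a \<Rightarrow> 'b"
  where "scaleR_fun c f = (\<lambda>x. c *\<^sub>R f x)"

instance
  by standard (simp_all add: scaleR_fun_def fun_eq_iff algebra_simps)

end

lemma scaleR_fun_apply [simp]: "(c *\<^sub>R f) x = c *\<^sub>R f x"
  by (simp add: scaleR_fun_def)


section \<open>Smooth manifolds\<close>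

text \<open>
  Both predicates are meant for an open set \<open>S\<close> of a finite-dimensional space, where a map is of
  class \<open>C\<^sup>k\<^sup>+\<^sup>1\<close> iff it is differentiable and all its directional derivatives are of
  class \<open>C\<^sup>k\<close>.
\<close>

primrec Ck_on :: "nat \<Rightarrow> ('e::real_normed_vector \<Rightarrow> 'f::real_normed_vector) \<Rightarrow> 'e set \<Rightarrow> bool" where
  "Ck_on 0 f S \<longleftrightarrow> continuous_on S f"
| "Ck_on (Suc k) f S \<longleftrightarrow>
     (\<forall>x\<in>S. f differentiable at x) \<and> (\<forall>v. Ck_on k (\<lambda>x. frechet_derivative f (at x) v) S)"

definition smooth_on :: "'e::real_normed_vector set \<Rightarrow> ('e \<Rightarrow> 'f::real_normed_vector) \<Rightarrow> bool"
  where "smooth_on S f \<longleftrightarrow> (\<forall>k. Ck_on k f S)"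

text \<open>
  A chart is a pair \<open>(U, \<phi>)\<close>; only the values of \<open>\<phi>\<close> on \<open>U\<close> matter, and the inverse
  \<open>\<phi> ` U \<rightarrow> U\<close> is \<open>inv_into U \<phi>\<close>.
\<close>

type_synonym ('a, 'e) chart = "'a set \<times> ('a \<Rightarrow> 'e)"

definition is_chart :: "'a topology \<Rightarrow> ('a, 'e::euclidean_space) chart \<Rightarrow> bool"
  where "is_chart T = (\<lambda>(U, \<phi>). openin T U \<and> open (\<phi> ` U) \<and>
           homeomorphic_map (subtopology T U) (top_of_set (\<phi> ` U)) \<phi>)"

definition smooth_atlas :: "'a topology \<Rightarrow> ('a, 'e::euclidean_space) chart set \<Rightarrow> bool"
  where "smooth_atlas T A \<longleftrightarrow>
    (\<forall>c\<in>A. is_chart T c) \<and>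
    (\<Union>(fst ` A) = topspace T) \<and>
    (\<forall>(U, \<phi>)\<in>A. \<forall>(V, \<psi>)\<in>A. smooth_on (\<phi> ` (U \<inter> V)) (\<psi> \<circ> inv_into U \<phi>))"

text \<open>The atlas need not be maximal: every notion below depends only on the smooth structure that
  it generates.  The dimension of the manifold is \<open>DIM('e)\<close>.\<close>

definition smooth_manifold :: "'a topology \<Rightarrow> ('a, 'e::euclidean_space) chart set \<Rightarrow> bool"
  where "smooth_manifold T A \<longleftrightarrow> Hausdorff_space T \<and> second_countable T \<and> smooth_atlas T A"

definition smooth_map ::
    "'a topology \<Rightarrow> ('a, 'e::euclidean_space) chart set \<Rightarrow>
     'b topology \<Rightarrow> ('b, 'f::euclidean_space) chart set \<Rightarrow> ('a \<Rightarrow> 'b) \<Rightarrow> bool"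
  where "smooth_map T A T' A' F \<longleftrightarrow>
    continuous_map T T' F \<and>
    (\<forall>(U, \<phi>)\<in>A. \<forall>(V, \<psi>)\<in>A'. smooth_on (\<phi> ` (U \<inter> F -` V)) (\<psi> \<circ> F \<circ> inv_into U \<phi>))"

definition prod_atlas ::
    "('a, 'e) chart set \<Rightarrow> ('b, 'f) chart set \<Rightarrow> ('a \<times> 'b, 'e \<times> 'f) chart set"
  where "prod_atlas A B = {(U \<times> V, map_prod \<phi> \<psi>) | U \<phi> V \<psi>. (U, \<phi>) \<in> A \<and> (V, \<psi>) \<in> B}"

text \<open>
  \<open>C\<^sup>\<infinity>(M)\<close>.  The values of the functions outside the manifold \<open>M = topspace T\<close> are
  unconstrained.  This is harmless: if \<open>h\<close> vanishes on \<open>M\<close> and \<open>h'\<close> is the indicator function of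
  the complement of \<open>M\<close>, then \<open>h = h * h'\<close>, so that every derivation at a point of \<open>M\<close> vanishes
  on \<open>h\<close>.
\<close>

definition smooth_functions :: "('a, 'e::euclidean_space) chart set \<Rightarrow> ('a \<Rightarrow> real) set"
  where "smooth_functions A = {f. \<forall>(U, \<phi>)\<in>A. smooth_on (\<phi> ` U) (f \<circ> inv_into U \<phi>)}"


section \<open>Tangent vectors and vector fields\<close>

type_synonym 'a tangent = "('a \<Rightarrow> real) \<Rightarrow> real"
type_synonym 'a vfield = "'a \<Rightarrow> 'a tangent"

text \<open>
  The tangent space at \<open>p\<close> consists of the derivations of \<open>C\<^sup>\<infinity>(M)\<close> at \<open>p\<close>, set to \<open>0\<close> on
  non-smooth functions so that equality of tangent vectors is equality of HOL functions.  For the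
  same reason vector fields are \<open>0\<close> outside the manifold.
\<close>

definition tangent_space :: "('a, 'e::euclidean_space) chart set \<Rightarrow> 'a \<Rightarrow> 'a tangent set"
  where "tangent_space A p = {v.
    (\<forall>f. f \<notin> smooth_functions A \<longrightarrow> v f = 0) \<and>
    (\<forall>f\<in>smooth_functions A. \<forall>h\<in>smooth_functions A. v (\<lambda>x. f x + h x) = v f + v h) \<and>
    (\<forall>c. \<forall>f\<in>smooth_functions A. v (\<lambda>x. c * f x) = c * v f) \<and>
    (\<forall>f\<in>smooth_functions A. \<forall>h\<in>smooth_functions A.
       v (\<lambda>x. f x * h x) = f p * v h + h p * v f)}"

definition differential ::
    "('b, 'f::euclidean_space) chart set \<Rightarrow> ('a \<Rightarrow> 'b) \<Rightarrow> 'a tangent \<Rightarrow> 'b tangent"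
  where "differential A' F v = (\<lambda>f. if f \<in> smooth_functions A' then v (f \<circ> F) else 0)"

definition vector_fields :: "'a topology \<Rightarrow> ('a, 'e::euclidean_space) chart set \<Rightarrow> 'a vfield set"
  where "vector_fields T A = {X.
    (\<forall>p\<in>topspace T. X p \<in> tangent_space A p) \<and>
    (\<forall>p. p \<notin> topspace T \<longrightarrow> X p = 0) \<and>
    (\<forall>f\<in>smooth_functions A. (\<lambda>p. X p f) \<in> smooth_functions A)}"

definition lie_bracket :: "'a vfield \<Rightarrow> 'a vfield \<Rightarrow> 'a vfield"
  where "lie_bracket X Y = (\<lambda>p f. X p (\<lambda>q. Y q f) - Y p (\<lambda>q. X q f))"


section \<open>Lorentzian metrics\<close>

definition symmetric_bilinear_on :: "'v::real_vector set \<Rightarrow> ('v \<Rightarrow> 'v \<Rightarrow> real) \<Rightarrow> bool"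
  where "symmetric_bilinear_on V b \<longleftrightarrow>
    (\<forall>u\<in>V. \<forall>v\<in>V. b u v = b v u) \<and>
    (\<forall>u\<in>V. \<forall>v\<in>V. \<forall>w\<in>V. b (u + v) w = b u w + b v w) \<and>
    (\<forall>c. \<forall>u\<in>V. \<forall>v\<in>V. b (c *\<^sub>R u) v = c * b u v)"

text \<open>Signature \<open>(-, +, \<dots>, +)\<close>: there is an orthonormal basis \<open>insert t S\<close> with exactly one
  timelike vector \<open>t\<close>.\<close>

definition lorentzian_form :: "'v::real_vector set \<Rightarrow> ('v \<Rightarrow> 'v \<Rightarrow> real) \<Rightarrow> bool"
  where "lorentzian_form V b \<longleftrightarrow>
    symmetric_bilinear_on V b \<and>
    (\<exists>t S. finite S \<and> t \<notin> S \<and> independent (insert t S) \<and> span (insert t S) = V \<and>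
       b t t = -1 \<and> (\<forall>s\<in>S. b s s = 1) \<and>
       (\<forall>x\<in>insert t S. \<forall>y\<in>insert t S. x \<noteq> y \<longrightarrow> b x y = 0))"

type_synonym 'a metric = "'a \<Rightarrow> 'a tangent \<Rightarrow> 'a tangent \<Rightarrow> real"

definition lorentzian_metric ::
    "'a topology \<Rightarrow> ('a, 'e::euclidean_space) chart set \<Rightarrow> 'a metric \<Rightarrow> bool"
  where "lorentzian_metric T A g \<longleftrightarrow>
    (\<forall>p\<in>topspace T. lorentzian_form (tangent_space A p) (g p)) \<and>
    (\<forall>X\<in>vector_fields T A. \<forall>Y\<in>vector_fields T A. (\<lambda>p. g p (X p) (Y p)) \<in> smooth_functions A)"

text \<open>\<open>(L\<^sub>X g)(Y, Z)\<close>, as a function on the manifold\<close>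

definition lie_derivative_metric ::
    "'a metric \<Rightarrow> 'a vfield \<Rightarrow> 'a vfield \<Rightarrow> 'a vfield \<Rightarrow> 'a \<Rightarrow> real"
  where "lie_derivative_metric g X Y Z = (\<lambda>p.
    X p (\<lambda>q. g q (Y q) (Z q)) - g p (lie_bracket X Y p) (Z p) - g p (Y p) (lie_bracket X Z p))"

definition conformal_field ::
    "'a topology \<Rightarrow> ('a, 'e::euclidean_space) chart set \<Rightarrow> 'a metric \<Rightarrow> 'a vfield \<Rightarrow> bool"
  where "conformal_field T A g X \<longleftrightarrow>
    X \<in> vector_fields T A \<and>
    (\<exists>\<rho>\<in>smooth_functions A. \<forall>Y\<in>vector_fields T A. \<forall>Z\<in>vector_fields T A. \<forall>p\<in>topspace T.
       lie_derivative_metric g X Y Z p = 2 * \<rho> p * g p (Y p) (Z p))"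

definition killing_field ::
    "'a topology \<Rightarrow> ('a, 'e::euclidean_space) chart set \<Rightarrow> 'a metric \<Rightarrow> 'a vfield \<Rightarrow> bool"
  where "killing_field T A g X \<longleftrightarrow>
    X \<in> vector_fields T A \<and>
    (\<forall>Y\<in>vector_fields T A. \<forall>Z\<in>vector_fields T A. \<forall>p\<in>topspace T.
       lie_derivative_metric g X Y Z p = 0)"


section \<open>Lie groups\<close>

definition lie_group ::
    "('a, 'm) monoid_scheme \<Rightarrow> 'a topology \<Rightarrow> ('a, 'e::euclidean_space) chart set \<Rightarrow> bool"
  where "lie_group G T A \<longleftrightarrow>
    group G \<and> topspace T = carrier G \<and> smooth_manifold T A \<and>
    smooth_map (prod_topology T T) (prod_atlas A A) T A (\<lambda>(x, y). x \<otimes>\<^bsub>G\<^esub> y) \<and>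
    smooth_map T A T A (\<lambda>x. inv\<^bsub>G\<^esub> x)"

definition left_translation :: "('a, 'm) monoid_scheme \<Rightarrow> 'a \<Rightarrow> 'a \<Rightarrow> 'a"
  where "left_translation G a = (\<lambda>x. a \<otimes>\<^bsub>G\<^esub> x)"

definition left_invariant_fields ::
    "('a, 'm) monoid_scheme \<Rightarrow> 'a topology \<Rightarrow> ('a, 'e::euclidean_space) chart set \<Rightarrow> 'a vfield set"
  where "left_invariant_fields G T A = {X \<in> vector_fields T A.
    \<forall>a\<in>carrier G. \<forall>x\<in>carrier G.
      X (a \<otimes>\<^bsub>G\<^esub> x) = differential A (left_translation G a) (X x)}"

definition left_invariant_metric ::
    "('a, 'm) monoid_scheme \<Rightarrow> ('a, 'e::euclidean_space) chart set \<Rightarrow> 'a metric \<Rightarrow> bool"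
  where "left_invariant_metric G A g \<longleftrightarrow>
    (\<forall>a\<in>carrier G. \<forall>x\<in>carrier G. \<forall>u\<in>tangent_space A x. \<forall>v\<in>tangent_space A x.
       g (a \<otimes>\<^bsub>G\<^esub> x) (differential A (left_translation G a) u)
                     (differential A (left_translation G a) v) = g x u v)"

definition metric_matrix :: "'a metric \<Rightarrow> ('n::finite \<Rightarrow> 'a vfield) \<Rightarrow> 'a \<Rightarrow> real^'n^'n"
  where "metric_matrix g e p = (\<chi> i j. g p (e i p) (e j p))"

end

theory Submission
  imports Defs
begin

text \<open>
  For left-invariant \<open>Y, Z\<close> the function \<open>\<langle>Y, Z\<rangle>\<close> is constant, so at a point where the conformal factor
  \<open>c\<close> does not vanish the conformal equation reads
  \<open>- \<langle>[X, Y], Z\<rangle> - \<langle>Y, [X, Z]\<rangle> = 2 c \<langle>Y, Z\<rangle>\<close>.  The choice \<open>Y = Z = X\<close> shows that \<open>X\<close> is null.  Complete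
  \<open>X\<close> by a null field \<open>W\<close> with \<open>\<langle>X, W\<rangle> = 1\<close>; then \<open>Y = Z = W\<close> and \<open>Y = X, Z = W\<close> give
  \<open>[X, W] = - 2 c W\<close>, and \<open>e\<^sub>1 = - X / (2 c)\<close>, \<open>e\<^sub>2 = - 2 c W\<close> is the required basis.

  The existence of \<open>W\<close> uses two facts on tangent vectors defined as derivations: they are directional derivatives in a chart (bump functions and the Hadamard lemma), and a tangent vector at
  the identity extends to a left-invariant field.
\<close>

section \<open>Smooth functions on open sets\<close>

text \<open>Failure to be Killing only provides some point, not necessarily the identity, and some
  vector fields, not necessarily left-invariant, at which the Lie derivative is nonzero. This
  suffices: the conformal factor is then nonzero at that point, and for left-invariant fields every
  other ingredient of the conformal equation is constant, so its instance at this single point is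
  already an algebraic identity on the Lie algebra. The obstacle lies in the tangent spaces. A
  Lorentzian form comes with an orthonormal basis of unspecified size, and the axioms of a
  derivation do not visibly bound that size; with more spacelike vectors, \<open>X\<close> and
  \<open>W\<close> would not span. Nor is it visible from these axioms that
  \<open>v (f \<circ> left_translation G p)\<close> is smooth in \<open>p\<close>. Both follow once
  a derivation is known to be differentiation in a fixed direction of a chart, hence the calculus
  that precedes the geometry.\<close>

lemma Ck_on_SucD:
  assumes "Ck_on (Suc k) f S" "x \<in> S"
  shows "(f has_derivative frechet_derivative f (at x)) (at x)"
  using assms by (simp add: frechet_derivative_works)

text \<open>On an open set the values on \<open>S\<close> determine all derivatives there. This
  makes the arbitrary values of \<open>inv_into\<close> off a chart image harmless.\<close>

lemma Ck_on_cong: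
  assumes "open S" "\<And>x. x \<in> S \<Longrightarrow> f x = g x" "Ck_on k f S"
  shows "Ck_on k g S"
  using assms(2,3)
proof (induction k arbitrary: f g)
  case 0
  then show ?case using continuous_on_cong[of S S f g] by simp
next
  case (Suc k)
  have D: "(g has_derivative frechet_derivative f (at x)) (at x)" if "x \<in> S" for x
    by (rule has_derivative_transform_within_open[OF Ck_on_SucD[OF Suc.prems(2) that] assms(1) that])
      (use Suc.prems(1) in auto)
  have E: "frechet_derivative f (at x) v = frechet_derivative g (at x) v" if "x \<in> S" for x v
    using frechet_derivative_at[OF D[OF that]] by simp
  have "Ck_on k (\<lambda>x. frechet_derivative g (at x) v) S" for v
    by (rule Suc.IH[of "\<lambda>x. frechet_derivative f (at x) v"]) (use E Suc.prems in auto)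
  then show ?case using D by (auto simp: differentiable_def)
qed

text \<open>By uniqueness of the derivative, any explicitly known derivative can replace the chosen
  \<open>frechet_derivative\<close>; the differentiation rules enter the inductions below in this
  form.\<close>

lemma Ck_on_SucI:
  assumes "open S" "\<And>x. x \<in> S \<Longrightarrow> (f has_derivative D x) (at x)"
    and "\<And>v. Ck_on k (\<lambda>x. D x v) S"
  shows "Ck_on (Suc k) f S"
proof -
  have "D x v = frechet_derivative f (at x) v" if "x \<in> S" for x v
    using frechet_derivative_at[OF assms(2)[OF that]] by simp
  then have "Ck_on k (\<lambda>x. frechet_derivative f (at x) v) S" for v
    by (rule Ck_on_cong[OF assms(1) _ assms(3)])
  then show ?thesis using assms(2) by (auto simp: differentiable_def)
qed

lemma Ck_on_subset: "Ck_on k f S \<Longrightarrow> R \<subseteq> S \<Longrightarrow> Ck_on k f R"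
  by (induction k arbitrary: f) (auto intro: continuous_on_subset)

lemma Ck_on_local:
  assumes "\<And>x. x \<in> S \<Longrightarrow> \<exists>W. open W \<and> x \<in> W \<and> Ck_on k f W"
  shows "Ck_on k f S"
  using assms
proof (induction k arbitrary: f)
  case 0
  then have "isCont f x" if "x \<in> S" for x
    using that continuous_on_eq_continuous_at by (metis Ck_on.simps(1))
  then show ?case by (auto intro: continuous_at_imp_continuous_on)
next
  case (Suc k)
  have "Ck_on k (\<lambda>x. frechet_derivative f (at x) v) S" for v
  proof (rule Suc.IH)
    fix x assume "x \<in> S"
    then show "\<exists>W. open W \<and> x \<in> W \<and> Ck_on k (\<lambda>x. frechet_derivative f (at x) v) W"
      using Suc.prems by fastforce
  qed
  moreover have "f differentiable at x" if "x \<in> S" for x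
    using Suc.prems[OF that] by auto
  ultimately show ?case by simp
qed

text \<open>The recursion at \<open>Suc k\<close> speaks about derivatives only; at the bottom of
  the induction, continuity comes from differentiability.\<close>

lemma Ck_on_decrease: "Ck_on (Suc k) f S \<Longrightarrow> Ck_on k f S"
proof (induction k arbitrary: f)
  case 0
  then show ?case
    by (auto intro!: continuous_at_imp_continuous_on differentiable_imp_continuous_within)
next
  case (Suc k)
  then have "Ck_on k (\<lambda>x. frechet_derivative f (at x) v) S" for v
    by (intro Suc.IH) simp
  with Suc.prems show ?case by simp
qed

lemma Ck_on_imp_continuous_on: "Ck_on k f S \<Longrightarrow> continuous_on S f"
proof (induction k)
  case (Suc k)
  show ?case by (rule Suc.IH[OF Ck_on_decrease[OF Suc.prems]])
qed simp

lemma Ck_on_const: "open S \<Longrightarrow> Ck_on k (\<lambda>x. c) S"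
proof (induction k arbitrary: c)
  case (Suc k)
  show ?case by (rule Ck_on_SucI[OF Suc.prems has_derivative_const]) (rule Suc.IH[OF Suc.prems])
qed simp

lemma Ck_on_bounded_linear:
  assumes "open S" "bounded_linear L" "Ck_on k f S"
  shows "Ck_on k (\<lambda>x. L (f x)) S"
  using assms(3)
proof (induction k arbitrary: f)
  case 0
  then show ?case using bounded_linear.continuous_on[OF assms(2)] by simp
next
  case (Suc k)
  show ?case
    by (rule Ck_on_SucI[OF assms(1) bounded_linear.has_derivative[OF assms(2) Ck_on_SucD[OF Suc.prems]]])
      (use Suc in auto)
qed

lemma Ck_on_id: "open S \<Longrightarrow> Ck_on k (\<lambda>x. x) S"
  by (cases k) (auto intro!: Ck_on_SucI[of _ _ "\<lambda>x v. v"] Ck_on_const)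

lemma Ck_on_add:
  assumes "open S" "Ck_on k f S" "Ck_on k g S"
  shows "Ck_on k (\<lambda>x. f x + g x) S"
  using assms(2,3)
proof (induction k arbitrary: f g)
  case 0
  then show ?case by (auto intro: continuous_intros)
next
  case (Suc k)
  show ?case
    by (rule Ck_on_SucI[OF assms(1) has_derivative_add[OF Ck_on_SucD[OF Suc.prems(1)] Ck_on_SucD[OF Suc.prems(2)]]])
      (use Suc in auto)
qed

lemma Ck_on_sum:
  assumes "open S" "\<And>i. i \<in> I \<Longrightarrow> Ck_on k (f i) S"
  shows "Ck_on k (\<lambda>x. \<Sum>i\<in>I. f i x) S"
  using assms(2)
  by (induction I rule: infinite_finite_induct) (auto intro: Ck_on_const Ck_on_add assms(1))

lemma Ck_on_scaleR:
  assumes "open S" "Ck_on k f S" "Ck_on k g S"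
  shows "Ck_on k (\<lambda>x. f x *\<^sub>R g x) S"
  using assms(2,3)
proof (induction k arbitrary: f g)
  case 0
  then show ?case by (auto intro: continuous_intros)
next
  case (Suc k)
  show ?case
  proof (rule Ck_on_SucI[OF assms(1) has_derivative_scaleR[OF Ck_on_SucD[OF Suc.prems(1)] Ck_on_SucD[OF Suc.prems(2)]]])
    fix v
    show "Ck_on k (\<lambda>x. f x *\<^sub>R frechet_derivative g (at x) v + frechet_derivative f (at x) v *\<^sub>R g x) S"
      using Suc.prems Ck_on_decrease[OF Suc.prems(1)] Ck_on_decrease[OF Suc.prems(2)]
      by (intro Ck_on_add[OF assms(1)] Suc.IH) auto
  qed
qed

lemma Ck_on_compose:
  fixes f :: "'e::real_normed_vector \<Rightarrow> 'f::euclidean_space"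
    and g :: "'f \<Rightarrow> 'g::real_normed_vector"
  assumes "open S" "f ` S \<subseteq> R" "Ck_on k f S" "Ck_on k g R"
  shows "Ck_on k (\<lambda>x. g (f x)) S"
  using assms(3,4)
proof (induction k arbitrary: g)
  case 0
  then show ?case using continuous_on_compose2[of R g S f] assms(2) by auto
next
  case (Suc k)
  have g': "(g has_derivative frechet_derivative g (at (f x))) (at (f x))" if "x \<in> S" for x
    using Ck_on_SucD[OF Suc.prems(2)] assms(2) that by blast
  show ?case
  proof (rule Ck_on_SucI[OF assms(1) has_derivative_compose[OF Ck_on_SucD[OF Suc.prems(1)] g']])
    fix v
    \<comment> \<open>The induction hypothesis covers derivatives of \<open>g\<close> in a fixed
      direction, but the chain rule produces a direction that varies with \<open>x\<close>.
      Expanding it in the basis moves the variation into scalar coefficients.\<close>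
    let ?h = "\<lambda>x. \<Sum>b\<in>Basis. (frechet_derivative f (at x) v \<bullet> b) *\<^sub>R frechet_derivative g (at (f x)) b"
    have "?h x = frechet_derivative g (at (f x)) (frechet_derivative f (at x) v)" if "x \<in> S" for x
    proof -
      interpret bounded_linear "frechet_derivative g (at (f x))"
        using g'[OF that] by (rule has_derivative_bounded_linear)
      show ?thesis
        by (simp add: sum[symmetric] scaleR[symmetric] euclidean_representation del: scaleR)
    qed
    moreover have "Ck_on k ?h S"
      using Suc.prems Ck_on_decrease[OF Suc.prems(1)]
      by (intro Ck_on_sum Ck_on_scaleR Ck_on_bounded_linear[OF _ bounded_linear_inner_left] assms(1) Suc.IH) auto
    ultimately show "Ck_on k (\<lambda>x. frechet_derivative g (at (f x)) (frechet_derivative f (at x) v)) S"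
      by (rule Ck_on_cong[OF assms(1)])
  qed auto
qed

section \<open>Closure properties of smooth maps\<close>

lemma smooth_on_imp_has_derivative:
  "smooth_on S f \<Longrightarrow> x \<in> S \<Longrightarrow> (f has_derivative frechet_derivative f (at x)) (at x)"
  using Ck_on_SucD unfolding smooth_on_def by blast

lemma smooth_on_frechet_derivative:
  assumes "smooth_on S f"
  shows "smooth_on S (\<lambda>x. frechet_derivative f (at x) v)"
  unfolding smooth_on_def
proof
  fix k
  from assms have "Ck_on (Suc k) f S" by (simp add: smooth_on_def del: Ck_on.simps)
  then show "Ck_on k (\<lambda>x. frechet_derivative f (at x) v) S" by simp
qed

lemma smooth_on_cong:
  "open S \<Longrightarrow> (\<And>x. x \<in> S \<Longrightarrow> f x = g x) \<Longrightarrow> smooth_on S f \<Longrightarrow> smooth_on S g"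
  unfolding smooth_on_def by (intro allI Ck_on_cong[of S f g]) auto

lemma smooth_on_subset: "smooth_on S f \<Longrightarrow> R \<subseteq> S \<Longrightarrow> smooth_on R f"
  by (simp add: smooth_on_def Ck_on_subset[of _ f S R])

lemma smooth_on_local:
  assumes "\<And>x. x \<in> S \<Longrightarrow> \<exists>W. open W \<and> x \<in> W \<and> smooth_on W f"
  shows "smooth_on S f"
  unfolding smooth_on_def
proof (intro allI Ck_on_local)
  fix k x assume "x \<in> S"
  from assms[OF this] show "\<exists>W. open W \<and> x \<in> W \<and> Ck_on k f W"
    unfolding smooth_on_def by blast
qed

lemma smooth_on_const: "open S \<Longrightarrow> smooth_on S (\<lambda>x. c)"
  by (simp add: smooth_on_def Ck_on_const)

lemma smooth_on_id: "open S \<Longrightarrow> smooth_on S (\<lambda>x. x)"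
  by (simp add: smooth_on_def Ck_on_id)

lemma smooth_on_add:
  "open S \<Longrightarrow> smooth_on S f \<Longrightarrow> smooth_on S g \<Longrightarrow> smooth_on S (\<lambda>x. f x + g x)"
  by (simp add: smooth_on_def Ck_on_add)

lemma smooth_on_sum:
  "open S \<Longrightarrow> (\<And>i. i \<in> I \<Longrightarrow> smooth_on S (f i)) \<Longrightarrow> smooth_on S (\<lambda>x. \<Sum>i\<in>I. f i x)"
  by (simp add: smooth_on_def Ck_on_sum)

lemma smooth_on_mult:
  fixes f g :: "'e::real_normed_vector \<Rightarrow> real"
  shows "open S \<Longrightarrow> smooth_on S f \<Longrightarrow> smooth_on S g \<Longrightarrow> smooth_on S (\<lambda>x. f x * g x)"
  using Ck_on_scaleR[of S _ f g] by (simp add: smooth_on_def)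

lemma smooth_on_bounded_linear:
  "open S \<Longrightarrow> bounded_linear L \<Longrightarrow> smooth_on S f \<Longrightarrow> smooth_on S (\<lambda>x. L (f x))"
  by (simp add: smooth_on_def Ck_on_bounded_linear)

lemma smooth_on_compose:
  fixes f :: "'e::real_normed_vector \<Rightarrow> 'f::euclidean_space"
  shows "open S \<Longrightarrow> f ` S \<subseteq> R \<Longrightarrow> smooth_on S f \<Longrightarrow> smooth_on R g \<Longrightarrow> smooth_on S (\<lambda>x. g (f x))"
  by (simp add: smooth_on_def Ck_on_compose[of S f R])

text \<open>A constant plus a bounded linear map. It serves to freeze the left factor of the group
  multiplication read in charts.\<close>

lemma smooth_on_Pair_right: "open S \<Longrightarrow> smooth_on S (\<lambda>y. (c, y))"
proof -
  assume S: "open S"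
  have "smooth_on S (\<lambda>y. (c, 0) + (0, y))"
    by (intro smooth_on_add smooth_on_const S
        smooth_on_bounded_linear[OF S bounded_linear_Pair[OF bounded_linear_zero bounded_linear_ident] smooth_on_id])
  then show ?thesis by simp
qed

lemma smooth_on_Pair_left: "open S \<Longrightarrow> smooth_on S (\<lambda>x. (x, c))"
proof -
  assume S: "open S"
  have "smooth_on S (\<lambda>x. (x, 0) + (0, c))"
    by (intro smooth_on_add smooth_on_const S
        smooth_on_bounded_linear[OF S bounded_linear_Pair[OF bounded_linear_ident bounded_linear_zero] smooth_on_id])
  then show ?thesis by simp
qed

section \<open>Bump functions from the flat function exp (- 1 / t)\<close>

definition flat_exp :: "nat \<Rightarrow> real \<Rightarrow> real"
  where "flat_exp n t = (if t \<le> 0 then 0 else inverse t ^ n * exp (- inverse t))"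

lemma flat_exp_has_real_derivative:
  "(flat_exp n has_real_derivative flat_exp (n + 2) t - real n * flat_exp (n + 1) t) (at t)"
proof (cases t "0::real" rule: linorder_cases)
  case less
  have "((\<lambda>x. 0) has_real_derivative 0) (at t)" by simp
  then have "(flat_exp n has_real_derivative 0) (at t)"
    by (rule has_field_derivative_transform_within_open[where S = "{..<0}"])
      (use less in \<open>auto simp: flat_exp_def\<close>)
  with less show ?thesis by (simp add: flat_exp_def)
next
  case greater
  have "((\<lambda>x. inverse x ^ n) has_real_derivative
      real n * (- (inverse t ^ Suc (Suc 0)) * inverse t ^ (n - Suc 0))) (at t)"
    by (rule DERIV_power[OF DERIV_inverse]) (use greater in simp)
  moreover have "((\<lambda>x. exp (- inverse x)) has_real_derivative
      exp (- inverse t) * - (- (inverse t ^ Suc (Suc 0)))) (at t)"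
    by (rule DERIV_fun_exp[OF DERIV_minus[OF DERIV_inverse]]) (use greater in simp)
  ultimately have "((\<lambda>x. inverse x ^ n * exp (- inverse x)) has_real_derivative
      real n * (- (inverse t ^ Suc (Suc 0)) * inverse t ^ (n - Suc 0)) * exp (- inverse t) +
      exp (- inverse t) * - (- (inverse t ^ Suc (Suc 0))) * inverse t ^ n) (at t)"
    by (rule DERIV_mult)
  moreover have "real n * (- (inverse t ^ Suc (Suc 0)) * inverse t ^ (n - Suc 0)) * exp (- inverse t) +
      exp (- inverse t) * - (- (inverse t ^ Suc (Suc 0))) * inverse t ^ n =
      flat_exp (n + 2) t - real n * flat_exp (n + 1) t"
    \<comment> \<open>The exponent \<open>n - Suc 0\<close> is a truncated difference; for
      \<open>n = 0\<close> the factor \<open>real n\<close> removes its term.\<close>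
    using greater by (cases n) (simp_all add: flat_exp_def algebra_simps)
  ultimately have "((\<lambda>x. inverse x ^ n * exp (- inverse x)) has_real_derivative
      flat_exp (n + 2) t - real n * flat_exp (n + 1) t) (at t)"
    by simp
  then show ?thesis
    by (rule has_field_derivative_transform_within_open[where S = "{0<..}"])
      (use greater in \<open>auto simp: flat_exp_def\<close>)
next
  case equal
  \<comment> \<open>At 0 the claimed derivative is 0. From the right, the difference quotient is
    s^(n+1) / exp s with s = 1 / y tending to infinity; from the left it is identically 0.\<close>
  have "((\<lambda>y. inverse y ^ Suc n / exp (inverse y)) \<longlongrightarrow> (0::real)) (at_right 0)"
    by (rule filterlim_compose[OF tendsto_power_div_exp_0 filterlim_inverse_at_top_right])
  moreover have "\<forall>\<^sub>F y in at_right 0. inverse y ^ Suc n / exp (inverse y) = flat_exp n y / y"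
    by (rule eventually_at_right_less[THEN eventually_mono])
      (auto simp: flat_exp_def exp_minus field_simps)
  ultimately have "((\<lambda>y. flat_exp n y / y) \<longlongrightarrow> 0) (at_right 0)"
    by (rule Lim_transform_eventually)
  moreover have "((\<lambda>y. flat_exp n y / y) \<longlongrightarrow> 0) (at_left 0)"
    by (rule Lim_transform_eventually[OF tendsto_const])
      (auto simp: eventually_at_filter flat_exp_def)
  ultimately have "((\<lambda>y. flat_exp n y / y) \<longlongrightarrow> 0) (at 0)"
    by (simp add: filterlim_split_at)
  then show ?thesis using equal by (simp add: DERIV_def flat_exp_def)
qed

text \<open>Differentiation keeps the span of the functions \<open>flat_exp n\<close> invariant, so
  the induction on the order runs for all \<open>n\<close> simultaneously.\<close>

lemma smooth_flat_exp: "smooth_on UNIV (flat_exp n)"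
proof -
  have "Ck_on k (flat_exp n) UNIV" for k
  proof (induction k arbitrary: n)
    case 0
    then show ?case
      using DERIV_isCont[OF flat_exp_has_real_derivative]
      by (auto intro: continuous_at_imp_continuous_on)
  next
    case (Suc k)
    have "(flat_exp n has_derivative (\<lambda>v. v *\<^sub>R (flat_exp (n + 2) t + (- real n) *\<^sub>R flat_exp (n + 1) t))) (at t)" for t
      using flat_exp_has_real_derivative[of n t] unfolding has_field_derivative_def
      by (rule has_derivative_eq_rhs) (simp add: fun_eq_iff)
    then show ?case
      by (rule Ck_on_SucI[OF open_UNIV])
        (intro Ck_on_scaleR Ck_on_add Ck_on_const open_UNIV Suc.IH)
  qed
  then show ?thesis by (simp add: smooth_on_def)
qed

lemma smooth_bump:
  fixes x0 :: "'e::euclidean_space"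
  assumes "r > 0"
  shows "\<exists>\<beta> :: 'e \<Rightarrow> real. smooth_on UNIV \<beta> \<and> \<beta> x0 = 1 \<and> (\<forall>x. x \<notin> cball x0 r \<longrightarrow> \<beta> x = 0)"
proof (intro exI conjI allI impI)
  \<comment> \<open>This is the squared radius minus the squared distance to \<open>x0\<close>,
    positive exactly inside the ball. It is spelled out with sums, products and linear coordinates
    so that the closure rules apply directly.\<close>
  let ?q = "\<lambda>x. r\<^sup>2 + (\<Sum>b\<in>Basis. (- 1) * (((x + - x0) \<bullet> b) * ((x + - x0) \<bullet> b)))"
  let ?\<beta> = "\<lambda>x. (1 / flat_exp 0 (r\<^sup>2)) * flat_exp 0 (?q x)"
  have q: "?q x = r\<^sup>2 - (dist x0 x)\<^sup>2" for x
  proof -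
    have "(dist x0 x)\<^sup>2 = (x - x0) \<bullet> (x - x0)"
      by (metis dist_commute dist_norm power2_norm_eq_inner)
    then show ?thesis
      using euclidean_inner[of "x - x0" "x - x0"] by (simp add: sum_negf)
  qed
  show "smooth_on UNIV ?\<beta>"
    by (intro smooth_on_mult smooth_on_const open_UNIV smooth_on_add smooth_on_sum smooth_on_id
        smooth_on_compose[OF _ _ _ smooth_flat_exp] smooth_on_bounded_linear[OF _ bounded_linear_inner_left]
        subset_UNIV)
  show "?\<beta> x0 = 1" using assms by (simp add: flat_exp_def)
  fix x assume "x \<notin> cball x0 r"
  then have "r < dist x0 x" by simp
  then have "?q x \<le> 0"
    unfolding q using power_mono[of r "dist x0 x" 2] assms by simp
  then show "?\<beta> x = 0" by (simp add: flat_exp_def)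
qed

section \<open>Integrals along segments and the Hadamard lemma\<close>

lemma segment_in_convex:
  fixes x0 x :: "'e::real_vector"
  assumes "convex S" "x0 \<in> S" "x \<in> S" "0 \<le> t" "t \<le> 1"
  shows "x0 + t *\<^sub>R (x - x0) \<in> S"
  using convexD[OF assms(1-3), of "1 - t" t] assms(4,5) by (simp add: algebra_simps)

lemma continuous_on_segments:
  fixes x0 :: "'e::real_normed_vector"
  assumes "convex S" "x0 \<in> S" "continuous_on S h"
  shows "continuous_on (S \<times> {0..1}) (\<lambda>z. h (x0 + snd z *\<^sub>R (fst z - x0)))"
  by (rule continuous_on_compose2[OF assms(3)])
    (auto intro!: continuous_intros segment_in_convex[OF assms(1,2)])

lemma continuous_on_segment:
  fixes x0 :: "'e::real_normed_vector"
  assumes "convex S" "x0 \<in> S" "x \<in> S" "continuous_on S h"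
  shows "continuous_on {0..1} (\<lambda>t. h (x0 + t *\<^sub>R (x - x0)))"
  by (rule continuous_on_compose2[OF assms(4)])
    (auto intro!: continuous_intros segment_in_convex[OF assms(1-3)])

lemma continuous_on_snd_comp:
  "continuous_on R c \<Longrightarrow> continuous_on (S \<times> R) (\<lambda>z. c (snd z))"
  by (rule continuous_on_compose2[of R c]) (auto intro: continuous_intros)

text \<open>Differentiation under the integral sign. Each derivative in \<open>x\<close> pulls out a
  factor \<open>t\<close>, which the weight \<open>c\<close> is there to absorb: the induction
  continues with the weight \<open>c t * t\<close>.\<close>

lemma Ck_on_integral_segment:
  fixes f :: "'e::euclidean_space \<Rightarrow> real" and c :: "real \<Rightarrow> real"
  assumes S: "open S" "convex S" "x0 \<in> S"
    and "continuous_on {0..1} c" "Ck_on k f S"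
  shows "Ck_on k (\<lambda>x. integral {0..1} (\<lambda>t. c t * f (x0 + t *\<^sub>R (x - x0)))) S"
  using assms(4,5)
proof (induction k arbitrary: c f)
  case 0
  have "continuous_on (S \<times> cbox 0 1) (\<lambda>(x, t). c t * f (x0 + t *\<^sub>R (x - x0)))"
    using continuous_on_mult[OF continuous_on_snd_comp[OF 0(1)] continuous_on_segments[OF S(2,3)]] 0(2)
    by (simp add: case_prod_unfold)
  from integral_continuous_on_param[OF this] show ?case by simp
next
  case (Suc k)
  have seg: "x0 + t *\<^sub>R (x - x0) \<in> S" if "x \<in> S" "t \<in> cbox 0 1" for x t
    using segment_in_convex[OF S(2,3) that(1)] that(2) by auto
  define D where "D = (\<lambda>x t v. (c t * t) * frechet_derivative f (at (x0 + t *\<^sub>R (x - x0))) v)"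
  have bl: "bounded_linear (D x t)" if "x \<in> S" "t \<in> cbox 0 1" for x t
    unfolding D_def
    by (intro bounded_linear_compose[OF bounded_linear_mult_right]
        has_derivative_bounded_linear[OF Ck_on_SucD[OF Suc.prems(2) seg[OF that]]])
  have cD: "continuous_on (S \<times> cbox 0 1) (\<lambda>(x, t). D x t v)" for v
  proof -
    have "Ck_on k (\<lambda>x. frechet_derivative f (at x) v) S"
      using Suc.prems(2) by simp
    then have "continuous_on S (\<lambda>x. frechet_derivative f (at x) v)"
      by (rule Ck_on_imp_continuous_on)
    from continuous_on_mult[OF continuous_on_snd_comp[OF continuous_on_mult[OF Suc.prems(1) continuous_on_id]]
        continuous_on_segments[OF S(2,3) this]]
    show ?thesis
      by (simp add: case_prod_unfold D_def)
  qed
  show ?case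
  proof (rule Ck_on_SucI[OF S(1)])
    fix x assume x: "x \<in> S"
    have "((\<lambda>x. integral (cbox 0 1) (\<lambda>t. c t * f (x0 + t *\<^sub>R (x - x0)))) has_derivative
        integral (cbox 0 1) (\<lambda>t. Blinfun (D x t))) (at x within S)"
    proof (rule leibniz_rule[OF _ _ _ x S(2)])
      fix y t assume yt: "y \<in> S" "t \<in> cbox (0::real) 1"
      have "((\<lambda>x. x0 + t *\<^sub>R (x - x0)) has_derivative (\<lambda>v. t *\<^sub>R v)) (at y)"
        by (auto intro!: derivative_eq_intros)
      from has_derivative_compose[OF this Ck_on_SucD[OF Suc.prems(2) seg[OF yt]]]
      have "((\<lambda>x. c t * f (x0 + t *\<^sub>R (x - x0))) has_derivative D y t) (at y)"
        unfolding D_def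
        by (rule derivative_eq_intros)
          (auto simp: linear_cmul[OF bounded_linear.linear[OF has_derivative_bounded_linear[OF Ck_on_SucD[OF Suc.prems(2) seg[OF yt]]]]])
      then show "((\<lambda>x. c t * f (x0 + t *\<^sub>R (x - x0))) has_derivative Blinfun (D y t)) (at y within S)"
        using bl[OF yt] by (simp add: bounded_linear_Blinfun_apply has_derivative_at_withinI)
    next
      fix y assume y: "y \<in> S"
      show "(\<lambda>t. c t * f (x0 + t *\<^sub>R (y - x0))) integrable_on cbox 0 1"
        using continuous_on_mult[OF Suc.prems(1) continuous_on_segment[OF S(2,3) y Ck_on_imp_continuous_on[OF Suc.prems(2)]]]
        by (intro integrable_continuous) simp
    next
      \<comment> \<open>The Leibniz rule needs the derivative to be continuous as an operator-valued
        map; in finite dimension it suffices to test the operators on basis vectors.\<close>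
      show "continuous_on (S \<times> cbox 0 1) (\<lambda>(x, t). Blinfun (D x t))"
      proof (rule continuous_on_blinfun_componentwise)
        fix i :: 'e
        show "continuous_on (S \<times> cbox 0 1) (\<lambda>z. blinfun_apply (case z of (x, t) \<Rightarrow> Blinfun (D x t)) i)"
          using cD[of i] bl
          by (elim continuous_on_cong[THEN iffD1, rotated 2]) (auto simp: bounded_linear_Blinfun_apply)
      qed
    qed
    moreover have "integral (cbox 0 1) (\<lambda>t. Blinfun (D x t)) v =
      integral {0..1} (\<lambda>t. D x t v)" for v
    proof -
      have "continuous_on (cbox 0 1) (\<lambda>t. Blinfun (D x t))"
      proof (rule continuous_on_blinfun_componentwise)
        fix i :: 'e
        have "continuous_on (cbox 0 1) (\<lambda>t. case (x, t) of (x, t) \<Rightarrow> D x t i)"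
          by (rule continuous_on_compose2[OF cD[of i]])
            (use x in \<open>auto intro!: continuous_on_Pair continuous_on_const continuous_on_id\<close>)
        then have "continuous_on (cbox 0 1) (\<lambda>t. D x t i)" by simp
        then show "continuous_on (cbox 0 1) (\<lambda>t. blinfun_apply (Blinfun (D x t)) i)"
          using bl[OF x]
          by (elim continuous_on_cong[THEN iffD1, rotated 2]) (auto simp: bounded_linear_Blinfun_apply)
      qed
      then have "(\<lambda>t. Blinfun (D x t)) integrable_on cbox 0 1"
        by (rule integrable_continuous)
      then have "integral (cbox 0 1) (\<lambda>t. Blinfun (D x t)) v =
          integral (cbox 0 1) (\<lambda>t. Blinfun (D x t) v)"
        by (rule blinfun_apply_integral)
      also have "\<dots> = integral (cbox 0 1) (\<lambda>t. D x t v)"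
        by (rule integral_cong) (use bl[OF x] in \<open>simp add: bounded_linear_Blinfun_apply\<close>)
      finally show ?thesis by simp
    qed
    ultimately show "((\<lambda>x. integral {0..1} (\<lambda>t. c t * f (x0 + t *\<^sub>R (x - x0)))) has_derivative
        (\<lambda>v. integral {0..1} (\<lambda>t. D x t v))) (at x)"
      unfolding at_within_open[OF x S(1)] by (auto elim!: has_derivative_eq_rhs)
  next
    fix v
    show "Ck_on k (\<lambda>x. integral {0..1} (\<lambda>t. D x t v)) S"
      unfolding D_def
      by (rule Suc.IH) (use Suc.prems in \<open>auto intro: continuous_intros\<close>)
  qed
qed

text \<open>Integrate the derivative of \<open>f\<close> along the segment from \<open>x0\<close> to
  \<open>x\<close>. \<open>G b x\<close> is the mean of the partial derivative in direction
  \<open>b\<close> over that segment; at \<open>x = x0\<close> the segment degenerates and the mean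
  is the partial derivative itself.\<close>

lemma Hadamard:
  fixes f :: "'e::euclidean_space \<Rightarrow> real"
  assumes S: "open S" "convex S" "x0 \<in> S" and f: "smooth_on S f"
  shows "\<exists>G. (\<forall>b. smooth_on S (G b)) \<and> (\<forall>b. G b x0 = frechet_derivative f (at x0) b) \<and>
    (\<forall>x\<in>S. f x = f x0 + (\<Sum>b\<in>Basis. ((x - x0) \<bullet> b) * G b x))"
proof (intro exI conjI allI ballI)
  let ?D = "\<lambda>x. frechet_derivative f (at x)"
  define G where "G = (\<lambda>b x. integral {0..1} (\<lambda>t. ?D (x0 + t *\<^sub>R (x - x0)) b))"
  have sD: "smooth_on S (\<lambda>x. ?D x b)" for b
    by (rule smooth_on_frechet_derivative[OF f])
  show "smooth_on S (G b)" for b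
    using Ck_on_integral_segment[OF S, of "\<lambda>t. 1" _ "\<lambda>x. ?D x b"] sD[of b]
    unfolding smooth_on_def G_def by simp
  show "G b x0 = ?D x0 b" for b by (simp add: G_def)
  fix x assume x: "x \<in> S"
  have seg: "x0 + t *\<^sub>R (x - x0) \<in> S" if "t \<in> {0..1}" for t
    using segment_in_convex[OF S(2,3) x] that by auto
  have ii: "(\<lambda>t. ?D (x0 + t *\<^sub>R (x - x0)) b) integrable_on {0..1}" for b
  proof -
    have "continuous_on S (\<lambda>x. ?D x b)"
      using sD[of b] by (metis Ck_on.simps(1) smooth_on_def)
    then show ?thesis
      by (intro integrable_continuous_real continuous_on_segment[OF S(2,3) x])
  qed
  have "((\<lambda>t. ?D (x0 + t *\<^sub>R (x - x0)) (x - x0)) has_integral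
      f (x0 + 1 *\<^sub>R (x - x0)) - f (x0 + 0 *\<^sub>R (x - x0))) {0..1}"
  proof (rule fundamental_theorem_of_calculus)
    fix t :: real assume t: "t \<in> {0..1}"
    have "((\<lambda>t. x0 + t *\<^sub>R (x - x0)) has_derivative (\<lambda>s. s *\<^sub>R (x - x0))) (at t)"
      by (auto intro!: derivative_eq_intros)
    from has_derivative_compose[OF this smooth_on_imp_has_derivative[OF f seg[OF t]]]
    show "((\<lambda>t. f (x0 + t *\<^sub>R (x - x0))) has_vector_derivative ?D (x0 + t *\<^sub>R (x - x0)) (x - x0)) (at t within {0..1})"
      using linear_cmul[OF bounded_linear.linear[OF has_derivative_bounded_linear[OF smooth_on_imp_has_derivative[OF f seg[OF t]]]]]
      by (simp add: has_vector_derivative_def has_derivative_at_withinI)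
  qed simp
  then have "f x - f x0 = integral {0..1} (\<lambda>t. ?D (x0 + t *\<^sub>R (x - x0)) (x - x0))"
    by (simp add: integral_unique)
  also have "\<dots> = integral {0..1} (\<lambda>t. \<Sum>b\<in>Basis. ((x - x0) \<bullet> b) * ?D (x0 + t *\<^sub>R (x - x0)) b)"
  proof (rule integral_cong)
    fix t :: real assume t: "t \<in> {0..1}"
    interpret bounded_linear "?D (x0 + t *\<^sub>R (x - x0))"
      by (rule has_derivative_bounded_linear[OF smooth_on_imp_has_derivative[OF f seg[OF t]]])
    have "?D (x0 + t *\<^sub>R (x - x0)) (\<Sum>b\<in>Basis. ((x - x0) \<bullet> b) *\<^sub>R b) =
        (\<Sum>b\<in>Basis. ((x - x0) \<bullet> b) * ?D (x0 + t *\<^sub>R (x - x0)) b)"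
      by (simp only: sum scaleR real_scaleR_def)
    then show "?D (x0 + t *\<^sub>R (x - x0)) (x - x0) = (\<Sum>b\<in>Basis. ((x - x0) \<bullet> b) * ?D (x0 + t *\<^sub>R (x - x0)) b)"
      by (simp add: euclidean_representation)
  qed
  also have "\<dots> = (\<Sum>b\<in>Basis. ((x - x0) \<bullet> b) * G b x)"
    unfolding G_def using ii integrable_cmul[OF ii]
    by (subst integral_sum) auto
  finally show "f x = f x0 + (\<Sum>b\<in>Basis. ((x - x0) \<bullet> b) * G b x)" by simp
qed

section \<open>Charts and tangent vectors\<close>

lemma is_chart_inj_on: "is_chart T (U, \<phi>) \<Longrightarrow> inj_on \<phi> U"
  using openin_subset[of T U]
  by (auto simp: is_chart_def homeomorphic_map_def inf.absorb2)

lemma is_chart_open_image: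
  assumes "is_chart T (U, \<phi>)" "openin T W" "W \<subseteq> U"
  shows "open (\<phi> ` W)"
proof -
  have "openin (subtopology T U) W"
    using assms by (simp add: is_chart_def openin_open_subtopology)
  moreover from this have "W \<subseteq> topspace (subtopology T U)"
    by (rule openin_subset)
  ultimately have "openin (top_of_set (\<phi> ` U)) (\<phi> ` W)"
    using assms(1) homeomorphic_map_openness[of "subtopology T U" "top_of_set (\<phi> ` U)" \<phi> W]
    by (simp add: is_chart_def)
  then show ?thesis
    using assms(1) by (auto simp: is_chart_def intro: openin_open_trans)
qed

text \<open>Transports the support of a bump function to the manifold, where the Hausdorff property
  then makes it closed.\<close>

lemma is_chart_compactin_preimage:
  assumes "is_chart T (U, \<phi>)" "compact K" "K \<subseteq> \<phi> ` U"
  shows "compactin T {q \<in> U. \<phi> q \<in> K}"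
proof -
  have U: "U \<subseteq> topspace T"
    using assms(1) by (auto simp: is_chart_def dest: openin_subset)
  have "\<phi> ` {q \<in> U. \<phi> q \<in> K} = K" using assms(3) by auto
  moreover have "compactin (top_of_set (\<phi> ` U)) K"
    using assms(2,3) by (simp add: compactin_subtopology)
  ultimately have "compactin (subtopology T U) {q \<in> U. \<phi> q \<in> K}"
    using assms(1) U homeomorphic_map_compactness[of "subtopology T U" "top_of_set (\<phi> ` U)" \<phi> "{q \<in> U. \<phi> q \<in> K}"]
    by (auto simp: is_chart_def)
  then show ?thesis by (simp add: compactin_subtopology)
qed

lemma inv_into_map_prod:
  assumes "inj_on \<phi> U" "inj_on \<psi> V" "x \<in> \<phi> ` U" "y \<in> \<psi> ` V"
  shows "inv_into (U \<times> V) (map_prod \<phi> \<psi>) (x, y) = (inv_into U \<phi> x, inv_into V \<psi> y)"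
  using assms by (intro inv_into_f_eq map_prod_inj_on) (auto simp: inv_into_into f_inv_into_f)

lemma is_chart_prod:
  assumes "is_chart T (U, \<phi>)" "is_chart T' (V, \<psi>)"
  shows "is_chart (prod_topology T T') (U \<times> V, map_prod \<phi> \<psi>)"
proof -
  obtain \<phi>' \<psi>' where
    "homeomorphic_maps (subtopology T U) (top_of_set (\<phi> ` U)) \<phi> \<phi>'"
    "homeomorphic_maps (subtopology T' V) (top_of_set (\<psi> ` V)) \<psi> \<psi>'"
    using assms unfolding is_chart_def homeomorphic_map_maps by auto
  then have "homeomorphic_maps (prod_topology (subtopology T U) (subtopology T' V))
      (prod_topology (top_of_set (\<phi> ` U)) (top_of_set (\<psi> ` V)))
      (\<lambda>(x, y). (\<phi> x, \<psi> y)) (\<lambda>(x, y). (\<phi>' x, \<psi>' y))"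
    by (simp only: homeomorphic_maps_prod simp_thms)
  moreover have "map_prod \<phi> \<psi> = (\<lambda>(x, y). (\<phi> x, \<psi> y))"
    by (simp add: fun_eq_iff)
  moreover have im: "map_prod \<phi> \<psi> ` (U \<times> V) = \<phi> ` U \<times> \<psi> ` V" by auto
  ultimately have "homeomorphic_map (subtopology (prod_topology T T') (U \<times> V))
      (top_of_set (map_prod \<phi> \<psi> ` (U \<times> V))) (map_prod \<phi> \<psi>)"
    unfolding homeomorphic_map_maps subtopology_Times im by auto
  then show ?thesis
    using assms unfolding is_chart_def
    by (simp add: im open_Times openin_prod_Times_iff)
qed

lemma smooth_functionsD:
  "f \<in> smooth_functions A \<Longrightarrow> (U, \<phi>) \<in> A \<Longrightarrow> smooth_on (\<phi> ` U) (f \<circ> inv_into U \<phi>)"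
  by (auto simp: smooth_functions_def)

text \<open>Near a point of \<open>U\<close>, the chart expression of \<open>f \<circ> F\<close> is
  that of \<open>F\<close> followed by that of \<open>f\<close>. The hypotheses ask for charts
  instead of manifolds so that \<open>prod_atlas A A\<close> qualifies as soon as its members are
  known to be charts.\<close>

lemma smooth_functions_pullback:
  assumes "\<And>c. c \<in> A \<Longrightarrow> is_chart T c" "\<And>c. c \<in> A' \<Longrightarrow> is_chart T' c"
    and "topspace T' \<subseteq> \<Union> (fst ` A')"
    and F: "smooth_map T A T' A' F" and f: "f \<in> smooth_functions A'"
  shows "f \<circ> F \<in> smooth_functions A"
proof -
  have "smooth_on (\<phi> ` U) (f \<circ> F \<circ> inv_into U \<phi>)" if U: "(U, \<phi>) \<in> A" for U \<phi>
  proof (rule smooth_on_local)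
    fix x assume "x \<in> \<phi> ` U"
    then obtain q where q: "q \<in> U" "x = \<phi> q" by auto
    have oU: "openin T U" and inj: "inj_on \<phi> U"
      using assms(1)[OF U] is_chart_inj_on by (auto simp: is_chart_def)
    have cF: "continuous_map T T' F" using F by (simp add: smooth_map_def)
    have qT: "q \<in> topspace T" using openin_subset[OF oU] q by auto
    then have "F q \<in> topspace T'" using continuous_map_image_subset_topspace[OF cF] by blast
    then obtain c where "c \<in> A'" "F q \<in> fst c" using assms(3) by blast
    then obtain V \<psi> where V: "(V, \<psi>) \<in> A'" "F q \<in> V" by (cases c) simp
    have "openin T {x \<in> topspace T. F x \<in> V}"
      using assms(2)[OF V(1)] by (intro openin_continuous_map_preimage[OF cF]) (simp add: is_chart_def)
    then have "openin T (U \<inter> {x \<in> topspace T. F x \<in> V})"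
      by (intro openin_Int oU)
    moreover have "U \<inter> {x \<in> topspace T. F x \<in> V} = U \<inter> F -` V"
      using openin_subset[OF oU] by auto
    ultimately have oW: "open (\<phi> ` (U \<inter> F -` V))"
      by (intro is_chart_open_image[OF assms(1)[OF U]]) auto
    have inV: "F (inv_into U \<phi> y) \<in> V" if "y \<in> \<phi> ` (U \<inter> F -` V)" for y
      using that inj by auto
    have "smooth_on (\<phi> ` (U \<inter> F -` V)) (\<psi> \<circ> F \<circ> inv_into U \<phi>)"
      using F U V(1) by (auto simp: smooth_map_def)
    then have "smooth_on (\<phi> ` (U \<inter> F -` V)) (\<lambda>x. (f \<circ> inv_into V \<psi>) ((\<psi> \<circ> F \<circ> inv_into U \<phi>) x))"
      by (rule smooth_on_compose[OF oW _ _ smooth_functionsD[OF f V(1)], rotated]) (use inV in auto)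
    then have "smooth_on (\<phi> ` (U \<inter> F -` V)) (f \<circ> F \<circ> inv_into U \<phi>)"
      by (rule smooth_on_cong[OF oW, rotated])
        (simp add: inV inv_into_f_f[OF is_chart_inj_on[OF assms(2)[OF V(1)]]])
    then show "\<exists>W. open W \<and> x \<in> W \<and> smooth_on W (f \<circ> F \<circ> inv_into U \<phi>)"
      using oW q V by (intro exI[of _ "\<phi> ` (U \<inter> F -` V)"]) auto
  qed
  then show ?thesis by (auto simp: smooth_functions_def)
qed

section \<open>The algebra of smooth functions on a manifold\<close>

locale smooth_mfd =
  fixes T :: "'a topology" and A :: "('a, 'e::euclidean_space) chart set"
  assumes manifold: "smooth_manifold T A"
begin

lemma chart: "c \<in> A \<Longrightarrow> is_chart T c"
  using manifold by (auto simp: smooth_manifold_def smooth_atlas_def)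

lemma chart_open: "(U, \<phi>) \<in> A \<Longrightarrow> open (\<phi> ` U)"
  using chart[of "(U, \<phi>)"] by (simp add: is_chart_def)

lemma chart_subset: "(U, \<phi>) \<in> A \<Longrightarrow> U \<subseteq> topspace T"
  using chart[of "(U, \<phi>)"] by (auto simp: is_chart_def dest: openin_subset)

lemma chart_inj_on: "(U, \<phi>) \<in> A \<Longrightarrow> inj_on \<phi> U"
  using chart is_chart_inj_on by blast

lemma chart_cover: "topspace T = \<Union> (fst ` A)"
  using manifold by (simp add: smooth_manifold_def smooth_atlas_def)

lemma obtain_chart:
  assumes "p \<in> topspace T"
  obtains U \<phi> where "(U, \<phi>) \<in> A" "p \<in> U"
proof -
  obtain c where "c \<in> A" "p \<in> fst c" using assms chart_cover by blast
  then show ?thesis by (cases c) (simp add: that)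
qed

text \<open>Allows the chart expression of \<open>f\<close> to be exhibited as any convenient
  \<open>h\<close>, with no reference to \<open>inv_into\<close>.\<close>

lemma smooth_functionsI:
  assumes "\<And>U \<phi>. (U, \<phi>) \<in> A \<Longrightarrow> \<exists>h. smooth_on (\<phi> ` U) h \<and> (\<forall>q\<in>U. h (\<phi> q) = f q)"
  shows "f \<in> smooth_functions A"
proof -
  have "smooth_on (\<phi> ` U) (f \<circ> inv_into U \<phi>)" if U: "(U, \<phi>) \<in> A" for U \<phi>
  proof -
    obtain h where h: "smooth_on (\<phi> ` U) h" "\<And>q. q \<in> U \<Longrightarrow> h (\<phi> q) = f q"
      using assms[OF U] by blast
    show ?thesis
      by (rule smooth_on_cong[OF chart_open[OF U] _ h(1)]) (use h(2) chart_inj_on[OF U] in auto)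
  qed
  then show ?thesis by (auto simp: smooth_functions_def)
qed

lemma smooth_functions_add:
  assumes "f \<in> smooth_functions A" "h \<in> smooth_functions A"
  shows "(\<lambda>x. f x + h x) \<in> smooth_functions A"
proof (rule smooth_functionsI)
  fix U \<phi> assume U: "(U, \<phi>) \<in> A"
  show "\<exists>k. smooth_on (\<phi> ` U) k \<and> (\<forall>q\<in>U. k (\<phi> q) = f q + h q)"
    using smooth_on_add[OF chart_open[OF U] smooth_functionsD[OF assms(1) U] smooth_functionsD[OF assms(2) U]]
      chart_inj_on[OF U] by (intro exI conjI) auto
qed

lemma smooth_functions_mult:
  assumes "f \<in> smooth_functions A" "h \<in> smooth_functions A"
  shows "(\<lambda>x. f x * h x) \<in> smooth_functions A"
proof (rule smooth_functionsI)
  fix U \<phi> assume U: "(U, \<phi>) \<in> A"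
  show "\<exists>k. smooth_on (\<phi> ` U) k \<and> (\<forall>q\<in>U. k (\<phi> q) = f q * h q)"
    using smooth_on_mult[OF chart_open[OF U] smooth_functionsD[OF assms(1) U] smooth_functionsD[OF assms(2) U]]
      chart_inj_on[OF U] by (intro exI conjI) auto
qed

lemma smooth_functions_const: "(\<lambda>x. c) \<in> smooth_functions A"
  by (rule smooth_functionsI) (auto intro: smooth_on_const chart_open)

lemma smooth_functions_scale: "f \<in> smooth_functions A \<Longrightarrow> (\<lambda>x. c * f x) \<in> smooth_functions A"
  by (intro smooth_functions_mult smooth_functions_const)

lemma smooth_functions_sum:
  "(\<And>i. i \<in> I \<Longrightarrow> f i \<in> smooth_functions A) \<Longrightarrow> (\<lambda>x. \<Sum>i\<in>I. f i x) \<in> smooth_functions A"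
  by (induction I rule: infinite_finite_induct)
    (auto intro: smooth_functions_const smooth_functions_add)

lemma smooth_functions_cong:
  assumes "f \<in> smooth_functions A" "\<And>q. q \<in> topspace T \<Longrightarrow> f q = h q"
  shows "h \<in> smooth_functions A"
proof (rule smooth_functionsI)
  fix U \<phi> assume U: "(U, \<phi>) \<in> A"
  show "\<exists>k. smooth_on (\<phi> ` U) k \<and> (\<forall>q\<in>U. k (\<phi> q) = h q)"
    using smooth_functionsD[OF assms(1) U] assms(2) chart_inj_on[OF U] chart_subset[OF U]
    by (intro exI conjI) auto
qed

text \<open>In another chart \<open>V\<close>, the part off the support and the part inside
  \<open>U\<close> cover everything. The function is 0 on the first and \<open>u\<close> after a
  transition map on the second. The first part is open because compact sets in a Hausdorff space are
  closed.\<close>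

lemma smooth_functions_extend:
  assumes U: "(U, \<phi>) \<in> A" and u: "smooth_on (\<phi> ` U) u"
    and K: "compact K" "K \<subseteq> \<phi> ` U" and zero: "\<And>x. x \<notin> K \<Longrightarrow> u x = 0"
  shows "(\<lambda>q. if q \<in> U then u (\<phi> q) else 0) \<in> smooth_functions A"
proof (rule smooth_functionsI)
  fix V \<psi> assume V: "(V, \<psi>) \<in> A"
  let ?F = "\<lambda>q. if q \<in> U then u (\<phi> q) else 0"
  let ?K = "{q \<in> U. \<phi> q \<in> K}"
  have oU: "openin T U" and oV: "openin T V"
    using chart[OF U] chart[OF V] by (auto simp: is_chart_def)
  have "closedin T ?K"
    using manifold is_chart_compactin_preimage[OF chart[OF U] K]
    by (intro compactin_imp_closedin) (auto simp: smooth_manifold_def)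
  then have o1: "open (\<psi> ` (V - ?K))"
    by (intro is_chart_open_image[OF chart[OF V]] openin_diff oV) auto
  have o2: "open (\<psi> ` (V \<inter> U))"
    by (intro is_chart_open_image[OF chart[OF V]] openin_Int oV oU) auto
  have zero': "x \<in> K" if "u x \<noteq> 0" for x
    using zero that by blast
  have s1: "smooth_on (\<psi> ` (V - ?K)) (?F \<circ> inv_into V \<psi>)"
    by (rule smooth_on_cong[OF o1 _ smooth_on_const[OF o1, of 0]])
      (use chart_inj_on[OF V] in \<open>auto intro: zero'\<close>)
  have "smooth_on (\<psi> ` (V \<inter> U)) (\<phi> \<circ> inv_into V \<psi>)"
    using manifold U V by (auto simp: smooth_manifold_def smooth_atlas_def)
  then have "smooth_on (\<psi> ` (V \<inter> U)) (\<lambda>x. u ((\<phi> \<circ> inv_into V \<psi>) x))"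
    by (rule smooth_on_compose[OF o2 _ _ u, rotated]) (use chart_inj_on[OF V] in auto)
  then have s2: "smooth_on (\<psi> ` (V \<inter> U)) (?F \<circ> inv_into V \<psi>)"
    by (rule smooth_on_cong[OF o2, rotated]) (use chart_inj_on[OF V] in auto)
  have "smooth_on (\<psi> ` V) (?F \<circ> inv_into V \<psi>)"
  proof (rule smooth_on_local)
    fix x assume "x \<in> \<psi> ` V"
    then have "x \<in> \<psi> ` (V - ?K) \<or> x \<in> \<psi> ` (V \<inter> U)" by auto
    then show "\<exists>W. open W \<and> x \<in> W \<and> smooth_on W (?F \<circ> inv_into V \<psi>)"
      using o1 o2 s1 s2 by blast
  qed
  then show "\<exists>h. smooth_on (\<psi> ` V) h \<and> (\<forall>q\<in>V. h (\<psi> q) = ?F q)"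
    using chart_inj_on[OF V] by (intro exI conjI) auto
qed

section \<open>Derivations at a point\<close>

lemma tangent_nonsmooth: "v \<in> tangent_space A p \<Longrightarrow> f \<notin> smooth_functions A \<Longrightarrow> v f = 0"
  by (simp add: tangent_space_def)

lemma tangent_add:
  "v \<in> tangent_space A p \<Longrightarrow> f \<in> smooth_functions A \<Longrightarrow> h \<in> smooth_functions A \<Longrightarrow>
    v (\<lambda>x. f x + h x) = v f + v h"
  by (simp add: tangent_space_def)

lemma tangent_scale:
  "v \<in> tangent_space A p \<Longrightarrow> f \<in> smooth_functions A \<Longrightarrow> v (\<lambda>x. c * f x) = c * v f"
  by (simp add: tangent_space_def)

lemma tangent_mult:
  "v \<in> tangent_space A p \<Longrightarrow> f \<in> smooth_functions A \<Longrightarrow> h \<in> smooth_functions A \<Longrightarrow>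
    v (\<lambda>x. f x * h x) = f p * v h + h p * v f"
  by (simp add: tangent_space_def)

lemma tangent_diff:
  assumes "v \<in> tangent_space A p" "f \<in> smooth_functions A" "h \<in> smooth_functions A"
  shows "v (\<lambda>x. f x - h x) = v f - v h"
  using tangent_add[OF assms(1,2) smooth_functions_scale[OF assms(3), of "-1"]]
    tangent_scale[OF assms(1,3), of "-1"] by simp

lemma smooth_functions_diff:
  assumes "f \<in> smooth_functions A" "h \<in> smooth_functions A"
  shows "(\<lambda>x. f x - h x) \<in> smooth_functions A"
  using smooth_functions_add[OF assms(1) smooth_functions_scale[OF assms(2), of "-1"]] by simp

text \<open>From 1 = 1 * 1 the product rule gives v 1 = 2 * v 1.\<close>

lemma tangent_const:
  assumes v: "v \<in> tangent_space A p"
  shows "v (\<lambda>x. c) = 0"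
  using tangent_mult[OF v smooth_functions_const[of 1] smooth_functions_const[of 1]]
    tangent_scale[OF v smooth_functions_const[of 1], of c] by simp

lemma tangent_sum:
  assumes v: "v \<in> tangent_space A p" and "\<And>i. i \<in> I \<Longrightarrow> f i \<in> smooth_functions A"
  shows "v (\<lambda>x. \<Sum>i\<in>I. f i x) = (\<Sum>i\<in>I. v (f i))"
  using assms(2)
  by (induction I rule: infinite_finite_induct)
    (auto simp: tangent_const[OF v] tangent_add[OF v] smooth_functions_sum)

text \<open>If \<open>d\<close> vanishes on the manifold and \<open>h\<close> is the indicator function of its complement,
  then \<open>d = d * h\<close>, and the product rule gives \<open>v d = 0\<close>.\<close>

lemma tangent_cong:
  assumes v: "v \<in> tangent_space A p" and p: "p \<in> topspace T"
    and eq: "\<And>q. q \<in> topspace T \<Longrightarrow> f q = h q"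
  shows "v f = v h"
proof (cases "f \<in> smooth_functions A")
  case True
  then have h: "h \<in> smooth_functions A" by (rule smooth_functions_cong) (rule eq)
  define d where "d = (\<lambda>x. f x - h x)"
  define k :: "'a \<Rightarrow> real" where "k = (\<lambda>q. if q \<in> topspace T then 0 else 1)"
  have d: "d \<in> smooth_functions A" unfolding d_def by (rule smooth_functions_diff[OF True h])
  have k: "k \<in> smooth_functions A"
    by (rule smooth_functions_cong[OF smooth_functions_const[of 0]]) (simp add: k_def)
  have "(\<lambda>x. d x * k x) = d" by (auto simp: fun_eq_iff d_def k_def eq)
  then have "v d = d p * v k + k p * v d" using tangent_mult[OF v d k] by simp
  then have "v d = 0" using p by (simp add: d_def k_def eq)
  then show ?thesis using tangent_diff[OF v True h] by (simp add: d_def)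
next
  case False
  then have "h \<notin> smooth_functions A" using smooth_functions_cong[of h f] eq by auto
  with False show ?thesis using tangent_nonsmooth[OF v] by simp
qed

text \<open>With \<open>B\<close> a bump function at \<open>p\<close>, the Hadamard lemma writes \<open>B\<^sup>2 (f - f p)\<close> as a finite sum of
  products of two smooth functions on the manifold, the first of which vanishes at \<open>p\<close>.\<close>

lemma tangent_eq_derivative:
  assumes v: "v \<in> tangent_space A p" and U: "(U, \<phi>) \<in> A" "p \<in> U"
  obtains w where "\<And>f. f \<in> smooth_functions A \<Longrightarrow>
    v f = frechet_derivative (f \<circ> inv_into U \<phi>) (at (\<phi> p)) w"
proof -
  define x0 where "x0 = \<phi> p"
  have "x0 \<in> \<phi> ` U" using U by (simp add: x0_def)
  then obtain r where r: "r > 0" "cball x0 r \<subseteq> \<phi> ` U"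
    using chart_open[OF U(1)] open_contains_cball by blast
  \<comment> \<open>The radius is halved so that the ball of radius \<open>r\<close> and the
    complement of the support overlap and cover the space; the product of \<open>\<beta>\<close>
    with a function smooth only on the ball is then smooth everywhere.\<close>
  obtain \<beta> :: "'e \<Rightarrow> real"
    where \<beta>: "smooth_on UNIV \<beta>" "\<beta> x0 = 1" "\<And>x. x \<notin> cball x0 (r / 2) \<Longrightarrow> \<beta> x = 0"
    using smooth_bump[OF half_gt_zero[OF r(1)], of x0] by blast
  define ext where "ext = (\<lambda>u q. if q \<in> U then \<beta> (\<phi> q) * u (\<phi> q) else 0)"
  have sub: "cball x0 (r / 2) \<subseteq> \<phi> ` U" "cball x0 (r / 2) \<subseteq> ball x0 r"
    using r by (auto simp: subset_iff)
  have ext: "ext u \<in> smooth_functions A" if u: "smooth_on (ball x0 r) u" for u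
  proof -
    have "smooth_on UNIV (\<lambda>x. \<beta> x * u x)"
    proof (rule smooth_on_local)
      fix x
      have o: "open (- cball x0 (r / 2))" by auto
      have "smooth_on (- cball x0 (r / 2)) (\<lambda>x. \<beta> x * u x)"
        by (rule smooth_on_cong[OF o _ smooth_on_const[OF o, of 0]]) (use \<beta>(3) in auto)
      moreover have "smooth_on (ball x0 r) (\<lambda>x. \<beta> x * u x)"
        by (intro smooth_on_mult u open_ball smooth_on_subset[OF \<beta>(1)]) auto
      moreover have "x \<in> - cball x0 (r / 2) \<or> x \<in> ball x0 r" using sub(2) by auto
      ultimately show "\<exists>W. open W \<and> x \<in> W \<and> smooth_on W (\<lambda>x. \<beta> x * u x)"
        using o open_ball by blast
    qed
    then show ?thesis
      unfolding ext_def
      by (intro smooth_functions_extend[OF U(1) _ compact_cball sub(1)])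
        (auto intro: smooth_on_subset simp: \<beta>(3))
  qed
  define B where "B = ext (\<lambda>x. 1)"
  define X where "X = (\<lambda>b. ext (\<lambda>x. (x + - x0) \<bullet> b))"
  have B: "B \<in> smooth_functions A" "B p = 1"
    using ext[OF smooth_on_const] U(2) \<beta>(2) by (auto simp: B_def ext_def x0_def)
  have X: "X b \<in> smooth_functions A" "X b p = 0" for b
  proof -
    have "smooth_on (ball x0 r) (\<lambda>x. (x + - x0) \<bullet> b)"
      by (intro smooth_on_bounded_linear[OF _ bounded_linear_inner_left] smooth_on_add smooth_on_id
          smooth_on_const open_ball)
    then show "X b \<in> smooth_functions A" unfolding X_def by (rule ext)
    show "X b p = 0" using U(2) by (simp add: X_def ext_def x0_def)
  qed
  \<comment> \<open>The coordinates of the direction are the values of \<open>v\<close> on the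
    cut-off coordinate functions, hence independent of \<open>f\<close>.\<close>
  define w where "w = (\<Sum>b\<in>Basis. v (X b) *\<^sub>R b)"
  have "v f = frechet_derivative (f \<circ> inv_into U \<phi>) (at x0) w" if f: "f \<in> smooth_functions A" for f
  proof -
    let ?f = "f \<circ> inv_into U \<phi>"
    have "smooth_on (ball x0 r) ?f"
      by (rule smooth_on_subset[OF smooth_functionsD[OF f U(1)]]) (use r in auto)
    moreover have "x0 \<in> ball x0 r" using r(1) by simp
    ultimately obtain G where G: "\<And>b. smooth_on (ball x0 r) (G b)"
      "\<And>b. G b x0 = frechet_derivative ?f (at x0) b"
      "\<And>x. x \<in> ball x0 r \<Longrightarrow> ?f x = ?f x0 + (\<Sum>b\<in>Basis. ((x - x0) \<bullet> b) * G b x)"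
      using Hadamard[OF open_ball convex_ball, of x0 x0 r ?f] by blast
    have G': "ext (G b) \<in> smooth_functions A" "ext (G b) p = G b x0" for b
      using ext[OF G(1)] U(2) \<beta>(2) by (auto simp: ext_def x0_def)
    have inv: "inv_into U \<phi> (\<phi> q) = q" if "q \<in> U" for q
      using chart_inj_on[OF U(1)] that by simp
    \<comment> \<open>Two factors \<open>B\<close> are needed: one cuts off the coordinate, the
      other cuts off \<open>G b\<close>. Where the bump vanishes, both sides are 0.\<close>
    have eq: "(\<lambda>q. (B q * B q) * (f q - f p)) = (\<lambda>q. \<Sum>b\<in>Basis. X b q * ext (G b) q)"
    proof
      fix q
      consider "q \<notin> U" | "q \<in> U" "\<phi> q \<notin> cball x0 (r / 2)" | "q \<in> U" "\<phi> q \<in> ball x0 r"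
        using sub(2) by blast
      then show "(B q * B q) * (f q - f p) = (\<Sum>b\<in>Basis. X b q * ext (G b) q)"
      proof cases
        case 3
        then have "f q - f p = (\<Sum>b\<in>Basis. ((\<phi> q - x0) \<bullet> b) * G b (\<phi> q))"
          using G(3)[OF 3(2)] inv U(2) by (simp add: x0_def)
        then show ?thesis
          using 3 by (simp add: B_def X_def ext_def sum_distrib_left algebra_simps)
      qed (auto simp: B_def X_def ext_def \<beta>(3))
    qed
    \<comment> \<open>At \<open>p\<close> the bump is 1 and \<open>f - f p\<close> is 0, so the
      product rule leaves only the derivative of \<open>f\<close>.\<close>
    have "v (\<lambda>q. (B q * B q) * (f q - f p)) = v f"
      using tangent_mult[OF v smooth_functions_mult[OF B(1) B(1)] smooth_functions_diff[OF f smooth_functions_const]]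
        tangent_diff[OF v f smooth_functions_const] tangent_const[OF v] B(2) by simp
    then have "v f = (\<Sum>b\<in>Basis. v (\<lambda>q. X b q * ext (G b) q))"
      unfolding eq by (simp add: tangent_sum[OF v] smooth_functions_mult X G')
    also have "\<dots> = (\<Sum>b\<in>Basis. v (X b) * frechet_derivative ?f (at x0) b)"
      by (rule sum.cong) (simp_all add: tangent_mult[OF v X(1) G'(1)] X(2) G' G(2) mult.commute)
    also have "\<dots> = frechet_derivative ?f (at x0) w"
    proof -
      interpret bounded_linear "frechet_derivative ?f (at x0)"
        using smooth_on_imp_has_derivative[OF smooth_functionsD[OF f U(1)] \<open>x0 \<in> \<phi> ` U\<close>]
        by (rule has_derivative_bounded_linear)
      show ?thesis by (simp only: w_def sum scaleR real_scaleR_def)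
    qed
    finally show ?thesis .
  qed
  then show ?thesis by (intro that) (simp add: x0_def)
qed

text \<open>Every derivation is some \<open>D w\<close> and \<open>D\<close> is linear in
  \<open>w\<close>, so the images of the basis vectors span. This bound is what limits an
  orthonormal basis of the metric to two vectors.\<close>

lemma tangent_space_card_le:
  assumes "p \<in> topspace T" "independent S" "S \<subseteq> tangent_space A p"
  shows "finite S \<and> card S \<le> DIM('e)"
proof -
  obtain U \<phi> where U: "(U, \<phi>) \<in> A" "p \<in> U" using obtain_chart[OF assms(1)] .
  \<comment> \<open>The default 0 on non-smooth functions follows the convention of
    \<open>tangent_space\<close>, so that \<open>v = D w\<close> is an equality of
    functions.\<close>
  define D where "D = (\<lambda>w f. if f \<in> smooth_functions A
    then frechet_derivative (f \<circ> inv_into U \<phi>) (at (\<phi> p)) w else 0)"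
  have D: "D w = (\<Sum>b\<in>Basis. (w \<bullet> b) *\<^sub>R D b)" for w
  proof
    fix f
    have sum_apply: "(\<Sum>b\<in>I. (w \<bullet> b) *\<^sub>R D b) f = (\<Sum>b\<in>I. (w \<bullet> b) * D b f)" for I
      by (induction I rule: infinite_finite_induct) auto
    show "D w f = (\<Sum>b\<in>Basis. (w \<bullet> b) *\<^sub>R D b) f"
    proof (cases "f \<in> smooth_functions A")
      case True
      interpret bounded_linear "frechet_derivative (f \<circ> inv_into U \<phi>) (at (\<phi> p))"
        using smooth_on_imp_has_derivative[OF smooth_functionsD[OF True U(1)]] U(2)
        by (blast intro: has_derivative_bounded_linear)
      have "frechet_derivative (f \<circ> inv_into U \<phi>) (at (\<phi> p)) (\<Sum>b\<in>Basis. (w \<bullet> b) *\<^sub>R b) =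
          (\<Sum>b\<in>Basis. (w \<bullet> b) * frechet_derivative (f \<circ> inv_into U \<phi>) (at (\<phi> p)) b)"
        by (simp only: sum scaleR real_scaleR_def)
      then show ?thesis
        unfolding sum_apply using True by (simp add: D_def euclidean_representation)
    next
      case False
      then show ?thesis unfolding sum_apply by (simp add: D_def)
    qed
  qed
  have "v \<in> span (D ` Basis)" if v: "v \<in> tangent_space A p" for v
  proof -
    obtain w where "\<And>f. f \<in> smooth_functions A \<Longrightarrow>
        v f = frechet_derivative (f \<circ> inv_into U \<phi>) (at (\<phi> p)) w"
      using tangent_eq_derivative[OF v U] by blast
    then have "v = D w" using tangent_nonsmooth[OF v] by (auto simp: D_def fun_eq_iff)
    then show ?thesis
      by (simp only: D[of w]) (intro span_sum span_scale span_base imageI)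
  qed
  then have "S \<subseteq> span (D ` Basis)" using assms(3) by blast
  then have "finite S \<and> card S \<le> card (D ` Basis)"
    by (intro independent_span_bound assms(2)) auto
  then show ?thesis using card_image_le[of Basis D] by fastforce
qed

end

section \<open>Left-invariant vector fields\<close>

locale lie_grp = smooth_mfd T A + group G
  for G :: "('a, 'm) monoid_scheme" (structure)
    and T :: "'a topology" and A :: "('a, 'e::euclidean_space) chart set" +
  assumes lie_group: "lie_group G T A"
begin

lemma topspace_eq: "topspace T = carrier G"
  using lie_group by (simp add: lie_group_def)

lemma smooth_functions_mult_pullback:
  assumes "f \<in> smooth_functions A"
  shows "f \<circ> (\<lambda>(x, y). x \<otimes> y) \<in> smooth_functions (prod_atlas A A)"
proof (rule smooth_functions_pullback[OF _ chart _ _ assms])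
  show "is_chart (prod_topology T T) c" if "c \<in> prod_atlas A A" for c
    using that chart is_chart_prod unfolding prod_atlas_def by blast
  show "smooth_map (prod_topology T T) (prod_atlas A A) T A (\<lambda>(x, y). x \<otimes> y)"
    using lie_group by (simp add: lie_group_def)
qed (simp_all add: chart_cover)

text \<open>Freezing the first variable gives smoothness of left translations; differentiating in
  the second gives smoothness of left-invariant extensions.\<close>

lemma smooth_on_mult_in_charts:
  assumes f: "f \<in> smooth_functions A" and U: "(U, \<phi>) \<in> A" and V: "(V, \<psi>) \<in> A"
  shows "smooth_on (\<phi> ` U \<times> \<psi> ` V) (\<lambda>z. f (inv_into U \<phi> (fst z) \<otimes> inv_into V \<psi> (snd z)))"
proof -
  have "(U \<times> V, map_prod \<phi> \<psi>) \<in> prod_atlas A A"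
    using U V unfolding prod_atlas_def by blast
  from smooth_functionsD[OF smooth_functions_mult_pullback[OF f] this]
  have "smooth_on (\<phi> ` U \<times> \<psi> ` V) (f \<circ> (\<lambda>(x, y). x \<otimes> y) \<circ> inv_into (U \<times> V) (map_prod \<phi> \<psi>))"
    by (simp add: map_prod_surj_on[OF refl refl])
  then show ?thesis
    by (rule smooth_on_cong[rotated 2])
      (auto simp: inv_into_map_prod[OF chart_inj_on[OF U] chart_inj_on[OF V]]
        intro!: open_Times chart_open U V)
qed

lemma smooth_functions_translate:
  assumes a: "a \<in> carrier G" and f: "f \<in> smooth_functions A"
  shows "f \<circ> left_translation G a \<in> smooth_functions A"
proof (rule smooth_functionsI)
  fix V \<psi> assume V: "(V, \<psi>) \<in> A"
  obtain U \<phi> where U: "(U, \<phi>) \<in> A" "a \<in> U" using obtain_chart a topspace_eq by blast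
  have "smooth_on (\<psi> ` V) (\<lambda>y. (\<lambda>z. f (inv_into U \<phi> (fst z) \<otimes> inv_into V \<psi> (snd z))) (\<phi> a, y))"
    by (rule smooth_on_compose[OF chart_open[OF V] _ smooth_on_Pair_right[OF chart_open[OF V]]
          smooth_on_mult_in_charts[OF f U(1) V]]) (use U in auto)
  then show "\<exists>h. smooth_on (\<psi> ` V) h \<and> (\<forall>q\<in>V. h (\<psi> q) = (f \<circ> left_translation G a) q)"
    using U(2) chart_inj_on[OF U(1)] chart_inj_on[OF V]
    by (intro exI conjI) (auto simp: left_translation_def)
qed

section \<open>Left-invariant extension of a tangent vector at the identity\<close>

definition left_extension :: "'a tangent \<Rightarrow> 'a vfield"
  where "left_extension v = (\<lambda>p f. if p \<in> carrier G \<and> f \<in> smooth_functions A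
    then v (f \<circ> left_translation G p) else 0)"

text \<open>In charts the value at \<open>p\<close> is the partial derivative of (x, y) \<mapsto> f
  (x y) in \<open>y\<close> at the identity, in a direction \<open>w\<close> that does not depend on
  \<open>p\<close>. It therefore inherits smoothness in \<open>x\<close> from the function of two
  variables.\<close>

lemma left_extension_smooth:
  assumes v: "v \<in> tangent_space A \<one>" and f: "f \<in> smooth_functions A"
  shows "(\<lambda>p. left_extension v p f) \<in> smooth_functions A"
proof (rule smooth_functionsI)
  fix U \<phi> assume U: "(U, \<phi>) \<in> A"
  obtain V \<psi> where V: "(V, \<psi>) \<in> A" "\<one> \<in> V" using obtain_chart topspace_eq by blast
  obtain w where w: "\<And>f. f \<in> smooth_functions A \<Longrightarrow>
      v f = frechet_derivative (f \<circ> inv_into V \<psi>) (at (\<psi> \<one>)) w"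
    using tangent_eq_derivative[OF v V] by blast
  define F where "F = (\<lambda>z. f (inv_into U \<phi> (fst z) \<otimes> inv_into V \<psi> (snd z)))"
  have F: "smooth_on (\<phi> ` U \<times> \<psi> ` V) F"
    unfolding F_def by (rule smooth_on_mult_in_charts[OF f U V(1)])
  let ?h = "\<lambda>x. frechet_derivative F (at (x, \<psi> \<one>)) (0, w)"
  have "smooth_on (\<phi> ` U) ?h"
    by (rule smooth_on_compose[OF chart_open[OF U] _ smooth_on_Pair_left[OF chart_open[OF U]]
          smooth_on_frechet_derivative[OF F, of "(0, w)"]]) (use V in auto)
  moreover have "?h (\<phi> q) = left_extension v q f" if q: "q \<in> U" for q
  proof -
    have qG: "q \<in> carrier G" using q chart_subset[OF U] topspace_eq by auto
    have "((\<lambda>y. (\<phi> q, y)) has_derivative (\<lambda>w. (0, w))) (at (\<psi> \<one>))"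
      by (intro has_derivative_Pair has_derivative_const has_derivative_ident)
    moreover have "(F has_derivative frechet_derivative F (at (\<phi> q, \<psi> \<one>))) (at (\<phi> q, \<psi> \<one>))"
      by (rule smooth_on_imp_has_derivative[OF F]) (use q V in auto)
    ultimately have "((\<lambda>y. F (\<phi> q, y)) has_derivative (\<lambda>w. frechet_derivative F (at (\<phi> q, \<psi> \<one>)) (0, w))) (at (\<psi> \<one>))"
      by (rule has_derivative_compose)
    moreover have "(\<lambda>y. F (\<phi> q, y)) = f \<circ> left_translation G q \<circ> inv_into V \<psi>"
      using q chart_inj_on[OF U] by (simp add: F_def left_translation_def fun_eq_iff)
    ultimately have "frechet_derivative (f \<circ> left_translation G q \<circ> inv_into V \<psi>) (at (\<psi> \<one>)) =
        (\<lambda>w. frechet_derivative F (at (\<phi> q, \<psi> \<one>)) (0, w))"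
      using frechet_derivative_at by fastforce
    then show ?thesis
      using qG f w[OF smooth_functions_translate[OF qG f]] by (simp add: left_extension_def)
  qed
  ultimately show "\<exists>h. smooth_on (\<phi> ` U) h \<and> (\<forall>q\<in>U. h (\<phi> q) = left_extension v q f)"
    by blast
qed

lemma left_extension_tangent:
  assumes v: "v \<in> tangent_space A \<one>" and p: "p \<in> carrier G"
  shows "left_extension v p \<in> tangent_space A p"
proof -
  note sm = smooth_functions_translate[OF p, unfolded o_def left_translation_def]
  show ?thesis
    unfolding tangent_space_def left_extension_def o_def left_translation_def
    using p by (simp add: smooth_functions_add smooth_functions_mult smooth_functions_scale
        tangent_add[OF v sm sm] tangent_mult[OF v sm sm] tangent_scale[OF v sm])
qed

lemma left_extension_one:
  assumes v: "v \<in> tangent_space A \<one>"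
  shows "left_extension v \<one> = v"
proof
  fix f
  \<comment> \<open>The two functions are only known to agree on the carrier, hence
    \<open>tangent_cong\<close>.\<close>
  have "v (f \<circ> left_translation G \<one>) = v f"
    by (rule tangent_cong[OF v]) (simp_all add: topspace_eq left_translation_def)
  then show "left_extension v \<one> f = v f"
    using tangent_nonsmooth[OF v] by (simp add: left_extension_def)
qed

lemma left_extension_invariant:
  assumes v: "v \<in> tangent_space A \<one>"
  shows "left_extension v \<in> left_invariant_fields G T A"
proof -
  have "left_extension v \<in> vector_fields T A"
    using left_extension_tangent[OF v] left_extension_smooth[OF v]
    by (auto simp: vector_fields_def topspace_eq) (simp add: left_extension_def fun_eq_iff)
  moreover have "left_extension v (a \<otimes> x) = differential A (left_translation G a) (left_extension v x)"
    if a: "a \<in> carrier G" and x: "x \<in> carrier G" for a x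
  proof
    fix f
    have "v (f \<circ> left_translation G (a \<otimes> x)) = v (f \<circ> left_translation G a \<circ> left_translation G x)"
      by (rule tangent_cong[OF v]) (simp_all add: topspace_eq left_translation_def m_assoc a x)
    then show "left_extension v (a \<otimes> x) f = differential A (left_translation G a) (left_extension v x) f"
      using a x smooth_functions_translate[OF a]
      by (simp add: differential_def left_extension_def)
  qed
  ultimately show ?thesis by (simp add: left_invariant_fields_def)
qed

section \<open>Left-invariant fields, their brackets and their inner products\<close>

lemma left_invariant_vector_field:
  "Y \<in> left_invariant_fields G T A \<Longrightarrow> Y \<in> vector_fields T A"
  by (simp add: left_invariant_fields_def)

lemma vector_field_tangent:
  "Y \<in> vector_fields T A \<Longrightarrow> p \<in> carrier G \<Longrightarrow> Y p \<in> tangent_space A p"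
  by (simp add: vector_fields_def topspace_eq)

lemma vector_field_outside:
  "Y \<in> vector_fields T A \<Longrightarrow> p \<notin> carrier G \<Longrightarrow> Y p = 0"
  by (simp add: vector_fields_def topspace_eq)

lemma vector_field_nonsmooth:
  "Y \<in> vector_fields T A \<Longrightarrow> f \<notin> smooth_functions A \<Longrightarrow> Y p f = 0"
  using vector_field_tangent vector_field_outside tangent_nonsmooth
  by (cases "p \<in> carrier G") fastforce+

lemma vector_field_smooth:
  assumes Y: "Y \<in> vector_fields T A"
  shows "(\<lambda>p. Y p f) \<in> smooth_functions A"
proof (cases "f \<in> smooth_functions A")
  case True
  then show ?thesis using Y by (simp add: vector_fields_def)
next
  case False
  then show ?thesis using vector_field_nonsmooth[OF Y] smooth_functions_const by simp
qed

lemma left_invariant_apply: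
  assumes "Y \<in> left_invariant_fields G T A" "a \<in> carrier G" "x \<in> carrier G"
    and "f \<in> smooth_functions A"
  shows "Y (a \<otimes> x) f = Y x (f \<circ> left_translation G a)"
  using assms by (simp add: left_invariant_fields_def differential_def)

text \<open>Since p = p 1, the value at the identity determines the field. Identities between
  left-invariant fields can thus be checked at the identity.\<close>

lemma left_invariant_eq_extension:
  assumes Y: "Y \<in> left_invariant_fields G T A"
  shows "Y = left_extension (Y \<one>)"
proof (intro ext)
  fix p f
  note Y' = left_invariant_vector_field[OF Y]
  show "Y p f = left_extension (Y \<one>) p f"
    using left_invariant_apply[OF Y _ one_closed, of p f] vector_field_nonsmooth[OF Y']
      vector_field_outside[OF Y', of p]
    by (auto simp: left_extension_def)
qed

text \<open>The bracket is the left extension of its own value at the identity, so smoothness and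
  invariance are inherited. Only the derivation axioms at the identity need computing, where the
  mixed products of first derivatives cancel.\<close>

lemma lie_bracket_left_invariant:
  assumes X: "X \<in> left_invariant_fields G T A" and Y: "Y \<in> left_invariant_fields G T A"
  shows "lie_bracket X Y \<in> left_invariant_fields G T A"
proof -
  note X' = left_invariant_vector_field[OF X] and Y' = left_invariant_vector_field[OF Y]
  have tangent: "lie_bracket X Y \<one> \<in> tangent_space A \<one>"
  proof -
    \<comment> \<open>These rules hold at every \<open>q\<close>, also off the group where
      \<open>Z q = 0\<close>, so they can rewrite under the binder inside the bracket.\<close>
    have add: "Z q (\<lambda>x. f x + h x) = Z q f + Z q h"
      and mult: "Z q (\<lambda>x. f x * h x) = f q * Z q h + h q * Z q f"
      and scale: "Z q (\<lambda>x. c * f x) = c * Z q f"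
      if "Z \<in> vector_fields T A" "f \<in> smooth_functions A" "h \<in> smooth_functions A" for Z f h q c
      using tangent_add[OF vector_field_tangent[OF that(1)] that(2,3)]
        tangent_mult[OF vector_field_tangent[OF that(1)] that(2,3)]
        tangent_scale[OF vector_field_tangent[OF that(1)] that(2)] vector_field_outside[OF that(1)]
      by (cases "q \<in> carrier G"; simp)+
    note tX = vector_field_tangent[OF X' one_closed] and tY = vector_field_tangent[OF Y' one_closed]
    note sm = vector_field_smooth[OF X'] vector_field_smooth[OF Y']
    show ?thesis
      unfolding tangent_space_def lie_bracket_def
      by (simp add: vector_field_nonsmooth[OF X'] vector_field_nonsmooth[OF Y']
          tangent_const[OF tX] tangent_const[OF tY]
          add[OF X'] add[OF Y'] mult[OF X'] mult[OF Y'] scale[OF X' _ smooth_functions_const] scale[OF Y' _ smooth_functions_const] sm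
          tangent_add[OF tX] tangent_add[OF tY] tangent_mult[OF tX] tangent_mult[OF tY]
          tangent_scale[OF tX] tangent_scale[OF tY] smooth_functions_mult algebra_simps)
  qed
  \<comment> \<open>Invariance of \<open>X\<close> moves the outer derivative to the identity;
    invariance of \<open>Y\<close> then moves the translation onto \<open>f\<close>, but only at
    points of the group.\<close>
  have "X p (\<lambda>q. Y q f) = X \<one> (\<lambda>q. Y q (f \<circ> left_translation G p))"
    if X: "X \<in> left_invariant_fields G T A" and Y: "Y \<in> left_invariant_fields G T A"
      and p: "p \<in> carrier G" and f: "f \<in> smooth_functions A" for X Y p f
  proof -
    have "X p (\<lambda>q. Y q f) = X \<one> ((\<lambda>q. Y q f) \<circ> left_translation G p)"
      using left_invariant_apply[OF X p one_closed vector_field_smooth[OF left_invariant_vector_field[OF Y]]] p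
      by simp
    also have "\<dots> = X \<one> (\<lambda>q. Y q (f \<circ> left_translation G p))"
      by (rule tangent_cong[OF vector_field_tangent[OF left_invariant_vector_field[OF X] one_closed]])
        (simp_all add: topspace_eq left_translation_def[of G p] left_invariant_apply[OF Y p _ f])
    finally show ?thesis .
  qed
  note translate = this[OF X Y] this[OF Y X]
  have "lie_bracket X Y = left_extension (lie_bracket X Y \<one>)"
  proof (intro ext)
    fix p f
    consider "p \<notin> carrier G" | "f \<notin> smooth_functions A" "p \<in> carrier G"
      | "p \<in> carrier G" "f \<in> smooth_functions A" by blast
    then show "lie_bracket X Y p f = left_extension (lie_bracket X Y \<one>) p f"
    proof cases
      case 1
      then show ?thesis
        using vector_field_outside[OF X'] vector_field_outside[OF Y']
        by (simp add: lie_bracket_def left_extension_def)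
    next
      case 2
      then show ?thesis
        using tangent_const[OF vector_field_tangent[OF X']] tangent_const[OF vector_field_tangent[OF Y']]
        by (simp add: lie_bracket_def left_extension_def vector_field_nonsmooth[OF X'] vector_field_nonsmooth[OF Y'])
    next
      case 3
      then show ?thesis using translate by (simp add: lie_bracket_def left_extension_def)
    qed
  qed
  then show ?thesis using left_extension_invariant[OF tangent] by simp
qed

lemma lie_bracket_scaleR:
  assumes "X \<in> vector_fields T A" "Y \<in> vector_fields T A"
  shows "lie_bracket (a *\<^sub>R X) (c *\<^sub>R Y) = (a * c) *\<^sub>R lie_bracket X Y"
proof (intro ext)
  fix p f
  have "Z p (\<lambda>q. k * Z' q f) = k * Z p (\<lambda>q. Z' q f)"
    if "Z \<in> vector_fields T A" "Z' \<in> vector_fields T A" for Z Z' k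
    using tangent_scale[OF vector_field_tangent[OF that(1)] vector_field_smooth[OF that(2)]]
      vector_field_outside[OF that(1)] by (cases "p \<in> carrier G") auto
  from this[OF assms] this[OF assms(2,1)]
  show "lie_bracket (a *\<^sub>R X) (c *\<^sub>R Y) p f = ((a * c) *\<^sub>R lie_bracket X Y) p f"
    by (simp add: lie_bracket_def algebra_simps)
qed

lemma left_invariant_metric_apply:
  assumes g: "left_invariant_metric G A g"
    and Y: "Y \<in> left_invariant_fields G T A" and Z: "Z \<in> left_invariant_fields G T A"
    and p: "p \<in> carrier G"
  shows "g p (Y p) (Z p) = g \<one> (Y \<one>) (Z \<one>)"
proof -
  have "W p = differential A (left_translation G p) (W \<one>)"
    if "W \<in> left_invariant_fields G T A" for W
  proof -
    have "W (p \<otimes> \<one>) = differential A (left_translation G p) (W \<one>)"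
      using that p one_closed unfolding left_invariant_fields_def by blast
    then show ?thesis using p by simp
  qed
  moreover have "g (p \<otimes> \<one>) (differential A (left_translation G p) (Y \<one>))
      (differential A (left_translation G p) (Z \<one>)) = g \<one> (Y \<one>) (Z \<one>)"
    using g p vector_field_tangent[OF left_invariant_vector_field[OF Y] one_closed]
      vector_field_tangent[OF left_invariant_vector_field[OF Z] one_closed]
    unfolding left_invariant_metric_def by blast
  ultimately show ?thesis using Y Z p by simp
qed

end

section \<open>Null vectors in a Lorentzian plane and the conformal equation\<close>

text \<open>In an orthonormal basis \<open>t\<close>, \<open>s\<close> the null vectors form the two
  diagonals. With \<open>u\<close> on one of them, \<open>w\<close> is taken on the other; in such a
  null basis the coordinate along one vector is the product with the other.\<close>

lemma lorentzian_plane_null_pair: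
  assumes lor: "lorentzian_form V b"
    and card_le: "\<And>S. independent S \<Longrightarrow> S \<subseteq> V \<Longrightarrow> card S \<le> 2"
    and u: "u \<in> V" "u \<noteq> 0" "b u u = 0"
  shows "\<exists>w\<in>V. b w w = 0 \<and> b u w = 1 \<and> (\<forall>y\<in>V. y = b y w *\<^sub>R u + b y u *\<^sub>R w)"
proof -
  have sym: "b x y = b y x" and add: "b (x + y) z = b x z + b y z" and scale: "b (c *\<^sub>R x) y = c * b x y"
    if "x \<in> V" "y \<in> V" "z \<in> V" for x y z c
    using lor that by (auto simp: lorentzian_form_def symmetric_bilinear_on_def)
  obtain t S where tS: "finite S \<and> t \<notin> S \<and> independent (insert t S) \<and> span (insert t S) = V \<and>
      b t t = -1 \<and> (\<forall>s\<in>S. b s s = 1) \<and>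
      (\<forall>x\<in>insert t S. \<forall>y\<in>insert t S. x \<noteq> y \<longrightarrow> b x y = 0)"
    using lor unfolding lorentzian_form_def by (elim conjE exE) (rule that, intro conjI)
  then have S: "finite S" "t \<notin> S" "independent (insert t S)" "span (insert t S) = V"
    and tt: "b t t = -1" and ss: "\<And>s. s \<in> S \<Longrightarrow> b s s = 1"
    and orth: "\<And>x y. x \<in> insert t S \<Longrightarrow> y \<in> insert t S \<Longrightarrow> x \<noteq> y \<Longrightarrow> b x y = 0"
    by blast+
  have V: "subspace V" using S(4) subspace_span by blast
  have SV: "insert t S \<subseteq> V" using S(4) span_superset by blast
  have "card S \<le> 1" using card_le[OF S(3) SV] S(1,2) by simp
  \<comment> \<open>Without a spacelike vector the form would be negative definite on a line,
    leaving no room for the null vector \<open>u\<close>.\<close>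
  moreover have "S \<noteq> {}"
  proof
    assume "S = {}"
    then obtain k where k: "u = k *\<^sub>R t" using u(1) S(4) by (auto simp: span_singleton)
    have tV: "t \<in> V" and kV: "k *\<^sub>R t \<in> V" using SV subspace_scale[OF V] by auto
    have "b u u = k * (k * b t t)"
      unfolding k by (simp only: scale[OF tV kV tV] sym[OF tV kV tV] scale[OF tV tV tV])
    then show False using u(2,3) tt k by simp
  qed
  ultimately have "card S = 1" using S(1) by (simp add: le_Suc_eq)
  then obtain s where "S = {s}" by (auto simp: card_1_singleton_iff)
  then have s: "t \<noteq> s" "b s s = 1" "b t s = 0" and span: "span {t, s} = V"
    using S ss orth[of t s] by auto
  have tV: "t \<in> V" and sV: "s \<in> V" using SV \<open>S = {s}\<close> by auto
  define L where "L = (\<lambda>a d. a *\<^sub>R t + d *\<^sub>R s)"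
  have LV: "L a d \<in> V" for a d
    unfolding L_def by (intro subspace_add[OF V] subspace_scale[OF V] tV sV)
  have bL: "b (L a d) z = a * b t z + d * b s z" if "z \<in> V" for a d z
    unfolding L_def using tV sV that
    by (simp add: add[of "a *\<^sub>R t" "d *\<^sub>R s"] scale[of t z] scale[of s z] subspace_scale[OF V])
  have bLL: "b (L a d) (L a' d') = d * d' - a * a'" for a d a' d'
  proof -
    have "b t (L a' d') = - a'" "b s (L a' d') = d'"
      using sym[OF tV LV LV] sym[OF sV LV LV] bL[OF tV] bL[OF sV] sym[OF sV tV tV] tt s by simp_all
    then show ?thesis by (simp add: bL[OF LV])
  qed
  have ex: "\<exists>a d. y = L a d" if "y \<in> V" for y
  proof -
    from that obtain a where "y - a *\<^sub>R t \<in> span {s}" by (auto simp flip: span simp: span_insert)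
    then obtain d where "y - a *\<^sub>R t = d *\<^sub>R s" by (auto simp: span_singleton)
    then have "y = L a d" by (simp add: L_def algebra_simps)
    then show ?thesis by blast
  qed
  obtain x y where uL: "u = L x y" using ex[OF u(1)] by blast
  have "y\<^sup>2 = x\<^sup>2" using u(3) by (simp add: uL bLL power2_eq_square)
  then have y: "y = x \<or> y = - x" by (simp add: power2_eq_iff)
  have x: "x \<noteq> 0" using u(2) y by (auto simp: uL L_def)
  then have y0: "y \<noteq> 0" using y by auto
  \<comment> \<open>With \<open>y = x\<close> or \<open>y = - x\<close>, these coordinates
    contribute 1/2 each to \<open>b u w\<close> and cancel in \<open>b w w\<close>.\<close>
  define w where "w = L (- 1 / (2 * x)) (1 / (2 * y))"
  have "b w w = 0" unfolding w_def bLL using y x by auto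
  moreover have "b u w = 1" unfolding w_def uL bLL using x y0 by simp
  moreover have "z = b z w *\<^sub>R u + b z u *\<^sub>R w" if zV: "z \<in> V" for z
  proof -
    obtain a d where z: "z = L a d" using ex[OF zV] by blast
    have lin: "k *\<^sub>R L p q + l *\<^sub>R L p' q' = L (k * p + l * p') (k * q + l * q')" for k l p q p' q'
      by (simp add: L_def algebra_simps)
    show ?thesis
      unfolding z w_def uL bLL lin using x y by (auto simp: field_simps)
  qed
  moreover have "w \<in> V" unfolding w_def by (rule LV)
  ultimately show ?thesis by blast
qed

theorem theorem4p1:
  fixes G :: "('a, 'm) monoid_scheme"
    and T :: "'a topology"
    and A :: "('a, real^2) chart set"
    and g :: "'a metric"
    and X :: "'a vfield"
  assumes "lie_group G T A"
    and "lorentzian_metric T A g"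
    and "left_invariant_metric G A g"
    and "X \<in> left_invariant_fields G T A"
    and "conformal_field T A g X"
    and "\<not> killing_field T A g X"
  shows "\<exists>e :: 2 \<Rightarrow> 'a vfield.
    inj e \<and> independent (range e) \<and> span (range e) = left_invariant_fields G T A \<and>
    lie_bracket (e 1) (e 2) = e 2 \<and>
    (\<forall>p\<in>carrier G. metric_matrix g e p = vector [vector [0, 1], vector [1, 0]]) \<and>
    (\<exists>x1. X = x1 *\<^sub>R e 1)"
proof -
  interpret group G using assms(1) by (simp add: lie_group_def)
  interpret lie_grp G T A
    using assms(1) by unfold_locales (simp_all add: lie_group_def)
  let ?L = "left_invariant_fields G T A"
  let ?one = "\<one>\<^bsub>G\<^esub>"
  let ?V = "tangent_space A ?one"
  define B where "B = (\<lambda>Y Z. g ?one (Y ?one) (Z ?one))"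
  have oneT: "?one \<in> topspace T" by (simp add: topspace_eq)
  have lor: "lorentzian_form ?V (g ?one)"
    using assms(2) oneT by (simp add: lorentzian_metric_def)
  \<comment> \<open>A Lorentzian form exhibits its space as a span.\<close>
  then have V: "subspace ?V"
    unfolding lorentzian_form_def by (metis subspace_span)
  have atV: "Y ?one \<in> ?V" if "Y \<in> ?L" for Y
    by (rule vector_field_tangent[OF left_invariant_vector_field[OF that] one_closed])
  \<comment> \<open>Left extension is linear and reaches every left-invariant field, so the subspace
    structure is carried over from the tangent space.\<close>
  have L: "subspace ?L"
  proof -
    have ext: "left_extension 0 = 0" "left_extension (u + v) = left_extension u + left_extension v"
      "left_extension (c *\<^sub>R u) = c *\<^sub>R left_extension u" for u v :: "'a tangent" and c
      by (auto simp: left_extension_def fun_eq_iff)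
    show ?thesis
    proof (rule subspaceI)
      show "0 \<in> ?L" using left_extension_invariant[OF subspace_0[OF V]] by (simp add: ext)
      show "Y + Z \<in> ?L" if "Y \<in> ?L" "Z \<in> ?L" for Y Z
        using left_extension_invariant[OF subspace_add[OF V atV atV, OF that]] that
        by (simp add: ext flip: left_invariant_eq_extension)
      show "c *\<^sub>R Y \<in> ?L" if "Y \<in> ?L" for c Y
        using left_extension_invariant[OF subspace_scale[OF V atV, OF that]] that
        by (simp add: ext flip: left_invariant_eq_extension)
    qed
  qed
  have B_sym: "B Y Z = B Z Y" and B_add: "B (Y + Z) W = B Y W + B Z W"
    and B_scale: "B (c *\<^sub>R Y) Z = c * B Y Z"
    if "Y \<in> ?L" "Z \<in> ?L" "W \<in> ?L" for Y Z W c
    using lor atV[OF that(1)] atV[OF that(2)] atV[OF that(3)]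
    by (auto simp: B_def lorentzian_form_def symmetric_bilinear_on_def)
  have metric: "g p (Y p) (Z p) = B Y Z" if "Y \<in> ?L" "Z \<in> ?L" "p \<in> carrier G" for Y Z p
    unfolding B_def by (rule left_invariant_metric_apply[OF assms(3) that])
  \<comment> \<open>\<open>c\<close> is the value of the conformal factor at a point where the
    Killing equation fails.\<close>
  obtain c where c: "c \<noteq> 0"
    and conf: "\<And>Y Z. Y \<in> ?L \<Longrightarrow> Z \<in> ?L \<Longrightarrow>
      - B (lie_bracket X Y) Z - B Y (lie_bracket X Z) = 2 * c * B Y Z"
  proof -
    obtain \<rho> where \<rho>: "\<And>Y Z p. Y \<in> vector_fields T A \<Longrightarrow> Z \<in> vector_fields T A \<Longrightarrow> p \<in> topspace T \<Longrightarrow>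
        lie_derivative_metric g X Y Z p = 2 * \<rho> p * g p (Y p) (Z p)"
      using assms(5) unfolding conformal_field_def by blast
    obtain Y Z p where "Y \<in> vector_fields T A" "Z \<in> vector_fields T A" and p: "p \<in> topspace T"
      and "lie_derivative_metric g X Y Z p \<noteq> 0"
      using assms(5,6) unfolding killing_field_def conformal_field_def by blast
    then have "\<rho> p \<noteq> 0" using \<rho> by fastforce
    moreover have "- B (lie_bracket X Y) Z - B Y (lie_bracket X Z) = 2 * \<rho> p * B Y Z"
      if Y: "Y \<in> ?L" and Z: "Z \<in> ?L" for Y Z
    proof -
      have pG: "p \<in> carrier G" using p topspace_eq by simp
      note Xp = vector_field_tangent[OF left_invariant_vector_field[OF assms(4)] pG]
      have "X p (\<lambda>q. g q (Y q) (Z q)) = X p (\<lambda>q. B Y Z)"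
        by (rule tangent_cong[OF Xp p]) (simp add: metric[OF Y Z] topspace_eq)
      also have "\<dots> = 0" by (rule tangent_const[OF Xp])
      finally show ?thesis
        using \<rho>[OF left_invariant_vector_field[OF Y] left_invariant_vector_field[OF Z] p]
          metric[OF lie_bracket_left_invariant[OF assms(4) Y] Z pG]
          metric[OF Y lie_bracket_left_invariant[OF assms(4) Z] pG] metric[OF Y Z pG]
        by (simp add: lie_derivative_metric_def)
    qed
    ultimately show ?thesis using that by blast
  qed
  have B_0: "B 0 Y = 0" "B Y 0 = 0" if "Y \<in> ?L" for Y
    using B_scale[of Y Y Y 0] B_sym[of 0 Y Y] that subspace_0[OF L] by auto
  have XX: "lie_bracket X X = 0" by (simp add: lie_bracket_def fun_eq_iff)
  have BXX: "B X X = 0" using conf[OF assms(4) assms(4)] B_0[OF assms(4)] c by (simp add: XX)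
  \<comment> \<open>If \<open>X\<close> vanished, \<open>conf\<close> with
    \<open>c \<noteq> 0\<close> would force the form to be 0, against the timelike vector
    \<open>t\<close>.\<close>
  have X0: "X ?one \<noteq> 0"
  proof
    assume "X ?one = 0"
    then have "X = 0"
      using left_invariant_eq_extension[OF assms(4)] by (simp add: left_extension_def fun_eq_iff)
    obtain t where t: "t \<in> ?V" "g ?one t t = -1"
      using lor unfolding lorentzian_form_def by (metis insertI1 span_base)
    let ?Y = "left_extension t"
    have Y: "?Y \<in> ?L" by (rule left_extension_invariant[OF t(1)])
    have "lie_bracket X ?Y = 0 *\<^sub>R lie_bracket ?Y ?Y"
      using lie_bracket_scaleR[OF left_invariant_vector_field[OF Y] left_invariant_vector_field[OF Y], of 0 1] \<open>X = 0\<close>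
      by simp
    then have "B ?Y ?Y = 0" using conf[OF Y Y] B_0[OF Y] c by simp
    then show False using t by (simp add: B_def left_extension_one)
  qed
  have "card S \<le> 2" if "independent S" "S \<subseteq> ?V" for S
    using tangent_space_card_le[OF oneT that] by simp
  from lorentzian_plane_null_pair[OF lor this atV[OF assms(4)] X0] BXX
  obtain w where w: "w \<in> ?V" "g ?one w w = 0" "g ?one (X ?one) w = 1"
    and dec: "\<And>y. y \<in> ?V \<Longrightarrow> y = g ?one y w *\<^sub>R X ?one + g ?one y (X ?one) *\<^sub>R w"
    unfolding B_def by blast
  define W where "W = left_extension w"
  have W: "W \<in> ?L" unfolding W_def by (rule left_extension_invariant[OF w(1)])
  have BWW: "B W W = 0" and BXW: "B X W = 1"
    using w by (simp_all add: B_def W_def left_extension_one)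
  have decomp: "Y = B Y W *\<^sub>R X + B Y X *\<^sub>R W" if Y: "Y \<in> ?L" for Y
  proof -
    have mem: "B Y W *\<^sub>R X + B Y X *\<^sub>R W \<in> ?L"
      by (intro subspace_add[OF L] subspace_scale[OF L] assms(4) W)
    have "Y ?one = (B Y W *\<^sub>R X + B Y X *\<^sub>R W) ?one"
      using dec[OF atV[OF Y]] w(1) by (simp add: B_def W_def left_extension_one)
    then show ?thesis
      using left_invariant_eq_extension[OF Y] left_invariant_eq_extension[OF mem] by simp
  qed
  have XW: "lie_bracket X W = (- 2 * c) *\<^sub>R W"
  proof -
    let ?Z = "lie_bracket X W"
    have Z: "?Z \<in> ?L" by (rule lie_bracket_left_invariant[OF assms(4) W])
    have "B ?Z W = 0" using conf[OF W W] B_sym[OF Z W W] BWW by simp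
    moreover have "B ?Z X = - 2 * c"
      using conf[OF assms(4) W] B_0[OF W] B_sym[OF Z assms(4) W] BXW by (simp add: XX)
    ultimately show ?thesis using decomp[OF Z] by simp
  qed
  \<comment> \<open>The factor of \<open>E1\<close> turns the bracket with \<open>W\<close> into
    \<open>W\<close> itself; \<open>E2\<close> takes the inverse factor, so that the product with
    \<open>E1\<close> stays 1.\<close>
  define E1 where "E1 = (- 1 / (2 * c)) *\<^sub>R X"
  define E2 where "E2 = (- 2 * c) *\<^sub>R W"
  have E: "E1 \<in> ?L" "E2 \<in> ?L"
    unfolding E1_def E2_def by (intro subspace_scale[OF L] assms(4) W)+
  have B_scale2: "B (a *\<^sub>R Y) (k *\<^sub>R Z) = a * k * B Y Z" if "Y \<in> ?L" "Z \<in> ?L" for a k Y Z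
    using that subspace_scale[OF L that(2), of k]
      B_scale[of Y "k *\<^sub>R Z" Y a] B_scale[of Z Y Y k] B_sym[of Y "k *\<^sub>R Z" Y] B_sym[of Y Z Y] by simp
  have BE: "B E1 E1 = 0" "B E1 E2 = 1" "B E2 E1 = 1" "B E2 E2 = 0"
    using BXX BXW BWW B_sym[OF W assms(4) W] c
    unfolding E1_def E2_def B_scale2[OF assms(4) assms(4)] B_scale2[OF assms(4) W]
      B_scale2[OF W assms(4)] B_scale2[OF W W] by simp_all
  have bracket: "lie_bracket E1 E2 = E2"
    unfolding E1_def E2_def XW
      lie_bracket_scaleR[OF left_invariant_vector_field[OF assms(4)] left_invariant_vector_field[OF W]]
    using c by simp
  have XE: "X = (- 2 * c) *\<^sub>R E1" and WE: "W = (- 1 / (2 * c)) *\<^sub>R E2"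
    using c by (simp_all add: E1_def E2_def)
  \<comment> \<open>A multiple of the null field \<open>E2\<close> is orthogonal to
    \<open>E2\<close>, whereas \<open>B E1 E2 = 1\<close>.\<close>
  have notin: "E1 \<notin> span {E2}"
  proof
    assume "E1 \<in> span {E2}"
    then obtain k where "E1 = k *\<^sub>R E2" by (auto simp: span_singleton)
    then show False using BE B_scale[OF E(2) E(2) E(2), of k] by simp
  qed
  have "E2 \<noteq> 0" using BE(2) B_0[OF E(1)] by auto
  then have indep: "independent {E1, E2}" using notin by (simp add: independent_insert)
  have span: "span {E1, E2} = ?L"
  proof (rule antisym)
    show "span {E1, E2} \<subseteq> ?L" by (rule span_minimal[OF _ L]) (use E in auto)
    show "?L \<subseteq> span {E1, E2}"
    proof
      fix Y assume "Y \<in> ?L"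
      then have "Y = B Y W *\<^sub>R (- 2 * c) *\<^sub>R E1 + B Y X *\<^sub>R (- 1 / (2 * c)) *\<^sub>R E2"
        using decomp XE WE by metis
      moreover have "\<dots> \<in> span {E1, E2}"
        by (intro span_add span_scale span_base) auto
      ultimately show "Y \<in> span {E1, E2}" by simp
    qed
  qed
  \<comment> \<open>The index type has only the elements 1 and 2, the latter coinciding with 0, so
    one case distinction defines the basis.\<close>
  define e :: "2 \<Rightarrow> 'a vfield" where "e = (\<lambda>i. if i = 1 then E1 else E2)"
  have e: "e 1 = E1" "e 2 = E2" by (simp_all add: e_def)
  have range: "range e = {E1, E2}" by (simp add: UNIV_2 e)
  have neq: "E1 \<noteq> E2" using notin span_base[of E2 "{E2}"] by auto
  have "inj e"
  proof (rule injI)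
    fix i j assume "e i = e j"
    then show "i = j" using exhaust_2[of i] exhaust_2[of j] neq e by auto
  qed
  moreover have "metric_matrix g e p = vector [vector [0, 1], vector [1, 0]]" if "p \<in> carrier G" for p
    by (simp add: metric_matrix_def vec_eq_iff forall_2 e metric[OF E(1) E(1) that]
        metric[OF E(1) E(2) that] metric[OF E(2) E(1) that] metric[OF E(2) E(2) that] BE)
  moreover have "\<exists>x1. X = x1 *\<^sub>R e 1" unfolding e using XE by blast
  ultimately show ?thesis
    using indep span bracket by (intro exI[of _ e]) (auto simp: range e)
qed

end
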